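(* Edge Dominating Set parameterized by the size of a given modulator $X$ to $P_5$-component graphs admits a kernelization whose output graph has $\mathcal{O}(|X|)$ vertices.
   Context: All graphs are finite, simple and undirected. $P_5$ denotes the path on five vertices (a path of length four). An edge dominating set of a graph $G$ is a set $F\subseteq E(G)$ such that every edge of $G$ shares at least one endpoint with an edge of $F$. A $P_5$-component graph is a graph every connected component of which is isomorphic to $P_5$. The problem has instances $(G,k,X)$ where $G$ is a graph, $k$ an integer and $X\subseteq V(G)$ with $G-X$ a $P_5$-component graph; it asks whether $G$ has an edge dominating set of size at most $k$; the parameter is $|X|$. A kernelization is a polynomial-time algorithm mapping each instance $(G,k,X)$ to an equivalent instance $(G',k',X')$ of the same problem whose size is bounded by a computable function of $|X|$. *)

theory Defs
  imports Complex_Main "HOL-Library.Landau_Symbols" "HOL-Computational_Algebra.Polynomial"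
begin

section \<open>Graphs\<close>

record 'a graph =
  verts :: "'a set"
  edges :: "'a set set"

definition simple_graph :: "'a graph \<Rightarrow> bool" where
  "simple_graph G \<longleftrightarrow> finite (verts G) \<and>
     (\<forall>e\<in>edges G. \<exists>u\<in>verts G. \<exists>v\<in>verts G. u \<noteq> v \<and> e = {u, v})"

definition induced_subgraph :: "'a graph \<Rightarrow> 'a set \<Rightarrow> 'a graph" where
  "induced_subgraph G S = \<lparr>verts = verts G \<inter> S, edges = {e \<in> edges G. e \<subseteq> S}\<rparr>"

definition delete_vertices :: "'a graph \<Rightarrow> 'a set \<Rightarrow> 'a graph" where
  "delete_vertices G X = induced_subgraph G (verts G - X)"

definition adjacency :: "'a graph \<Rightarrow> ('a \<times> 'a) set" where
  "adjacency G = {(u, v). {u, v} \<in> edges G}"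

definition connected_components :: "'a graph \<Rightarrow> 'a graph set" where
  "connected_components G =
     (\<lambda>u. induced_subgraph G ((adjacency G)\<^sup>* `` {u})) ` verts G"

definition graph_isomorphic :: "'a graph \<Rightarrow> 'b graph \<Rightarrow> bool" where
  "graph_isomorphic G H \<longleftrightarrow>
     (\<exists>f. bij_betw f (verts G) (verts H) \<and>
        (\<forall>u\<in>verts G. \<forall>v\<in>verts G. {u, v} \<in> edges G \<longleftrightarrow> {f u, f v} \<in> edges H))"

definition path_graph :: "nat \<Rightarrow> nat graph" where
  "path_graph n = \<lparr>verts = {..<n}, edges = {{i, Suc i} | i. Suc i < n}\<rparr>"

definition P5_component_graph :: "'a graph \<Rightarrow> bool" where
  "P5_component_graph G \<longleftrightarrow>
     (\<forall>C\<in>connected_components G. graph_isomorphic C (path_graph 5))"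

definition edge_dominating_set :: "'a graph \<Rightarrow> 'a set set \<Rightarrow> bool" where
  "edge_dominating_set G F \<longleftrightarrow>
     F \<subseteq> edges G \<and> (\<forall>e\<in>edges G. \<exists>f\<in>F. e \<inter> f \<noteq> {})"

section \<open>Computation\<close>

text \<open>
  Algorithms are programs of the WHILE language over binary trees (N. D. Jones,
  Computability and Complexity from a Programming Perspective) with a single variable,
  under Jones' unit-cost measure: one time unit for each operation. Copying a
  tree is copying a pointer, so after \<open>t\<close> steps the store is a directed acyclic graph with
  at most \<open>t\<close> nodes in addition to those of the input. Hence a Turing machine can simulate
  a program with polynomial overhead, and conversely.
\<close>

datatype data = Leaf | Node data data

datatype expr = Var | Empty | Pair expr expr | Left expr | Right expr

datatype cmd = Assign expr | Seq cmd cmd | While expr cmd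

fun left :: "data \<Rightarrow> data" where
  "left Leaf = Leaf"
| "left (Node l r) = l"

fun right :: "data \<Rightarrow> data" where
  "right Leaf = Leaf"
| "right (Node l r) = r"

primrec eval_expr :: "expr \<Rightarrow> data \<Rightarrow> data" where
  "eval_expr Var x = x"
| "eval_expr Empty x = Leaf"
| "eval_expr (Pair a b) x = Node (eval_expr a x) (eval_expr b x)"
| "eval_expr (Left a) x = left (eval_expr a x)"
| "eval_expr (Right a) x = right (eval_expr a x)"

primrec cost :: "expr \<Rightarrow> nat" where
  "cost Var = 1"
| "cost Empty = 1"
| "cost (Pair a b) = 1 + cost a + cost b"
| "cost (Left a) = 1 + cost a"
| "cost (Right a) = 1 + cost a"

text \<open>
  \<open>exec c x y t\<close>: started with store \<open>x\<close>, the program \<open>c\<close> halts with store \<open>y\<close> after \<open>t\<close>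
  time units. A loop guard counts as true if its value is not \<open>Leaf\<close>.
\<close>

inductive exec :: "cmd \<Rightarrow> data \<Rightarrow> data \<Rightarrow> nat \<Rightarrow> bool" where
  exec_Assign: "exec (Assign e) x (eval_expr e x) (1 + cost e)"
| exec_Seq: "\<lbrakk>exec c x y s; exec d y z t\<rbrakk> \<Longrightarrow> exec (Seq c d) x z (s + t)"
| exec_While_stop: "eval_expr e x = Leaf \<Longrightarrow> exec (While e c) x x (1 + cost e)"
| exec_While_step: "\<lbrakk>eval_expr e x \<noteq> Leaf; exec c x y s; exec (While e c) y z t\<rbrakk>
    \<Longrightarrow> exec (While e c) x z (1 + cost e + s + t)"

inductive_cases exec_AssignE: "exec (Assign e) x y t"
inductive_cases exec_SeqE: "exec (Seq c d) x y t"
inductive_cases exec_WhileE: "exec (While e c) x y t"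

lemma exec_deterministic:
  assumes "exec c x y s" "exec c x z t"
  shows "y = z \<and> s = t"
  using assms
proof (induction arbitrary: z t rule: exec.induct)
  case (exec_Assign e x)
  show ?case
    by (rule exec_AssignE[OF exec_Assign.prems]) simp
next
  case (exec_Seq c x y s d w t')
  from exec_Seq.prems obtain y' s' u
    where 1: "exec c x y' s'" and 2: "exec d y' z u" and t: "t = s' + u"
    by (rule exec_SeqE)
  have y: "y = y'" and s: "s = s'"
    using exec_Seq.IH(1)[OF 1] by (rule conjunct1, rule conjunct2)
  show ?case
    using exec_Seq.IH(2)[OF 2[folded y]] unfolding t s by (rule conjE) (rule conjI, assumption, simp only:)
next
  case (exec_While_stop e x c)
  show ?case
    by (rule exec_WhileE[OF exec_While_stop.prems]) (simp_all only: exec_While_stop.hyps simp_thms not_True_eq_False)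
next
  case (exec_While_step e x c y s w t')
  show ?case
  proof (rule exec_WhileE[OF exec_While_step.prems])
    assume "eval_expr e x = Leaf"
    with exec_While_step.hyps(1) show ?thesis by (rule notE)
  next
    fix y' s' u
    assume 1: "exec c x y' s'" and 2: "exec (While e c) y' z u" and t: "t = Suc (cost e + s' + u)"
    have y: "y = y'" and s: "s = s'"
      using exec_While_step.IH(1)[OF 1] by (rule conjunct1, rule conjunct2)
    show ?thesis
      using exec_While_step.IH(2)[OF 2[folded y]] unfolding t s
      by (rule conjE) (rule conjI, assumption, simp)
  qed
qed

text \<open>
  Polynomial-time computability of a function on a set \<open>A\<close> of inputs (a promise: nothing is
  required outside \<open>A\<close>). The input length is \<open>size\<close>, the number of \<open>Node\<close>s of the code.
\<close>

definition polytime_on :: "('i \<Rightarrow> data) \<Rightarrow> 'i set \<Rightarrow> ('i \<Rightarrow> 'i) \<Rightarrow> bool" where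
  "polytime_on enc A K \<longleftrightarrow>
     (\<exists>(c :: cmd) (p :: nat poly). \<forall>I\<in>A. \<exists>t.
        exec c (enc I) (enc (K I)) t \<and> t \<le> poly p (size (enc I)))"

text \<open>Unary coding; it is used only where running time does not matter.\<close>

definition encode_unary :: "nat \<Rightarrow> data" where
  "encode_unary n = (Node Leaf ^^ n) Leaf"

definition computable :: "(nat \<Rightarrow> nat) \<Rightarrow> bool" where
  "computable h \<longleftrightarrow> (\<exists>c. \<forall>n. \<exists>t. exec c (encode_unary n) (encode_unary (h n)) t)"

section \<open>Edge Dominating Set with a modulator to \<open>P\<^sub>5\<close>-component graphs\<close>

record eds_instance =
  graph :: "nat graph"
  budget :: int
  modulator :: "nat set"

text \<open>As usual for inputs of algorithms, the vertices of a graph are numbered from 0.\<close>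

definition eds_instances :: "eds_instance set" where
  "eds_instances = {I.
     simple_graph (graph I) \<and> (\<exists>n. verts (graph I) = {..<n}) \<and>
     modulator I \<subseteq> verts (graph I) \<and>
     P5_component_graph (delete_vertices (graph I) (modulator I))}"

definition eds_yes :: "eds_instance \<Rightarrow> bool" where
  "eds_yes I \<longleftrightarrow>
     (\<exists>F. edge_dominating_set (graph I) F \<and> int (card F) \<le> budget I)"

definition parameter :: "eds_instance \<Rightarrow> nat" where
  "parameter I = card (modulator I)"

text \<open>
  An instance is coded by the adjacency matrix of the graph, the characteristic vector of the
  modulator, and the budget as a sign followed by the binary digits of the absolute value,
  least significant digit first.
\<close>

definition encode_bool :: "bool \<Rightarrow> data" where
  "encode_bool b = (if b then Node Leaf Leaf else Leaf)"

primrec encode_list :: "('a \<Rightarrow> data) \<Rightarrow> 'a list \<Rightarrow> data" where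
  "encode_list enc [] = Leaf"
| "encode_list enc (a # as) = Node (enc a) (encode_list enc as)"

fun binary_digits :: "nat \<Rightarrow> bool list" where
  "binary_digits n = (if n = 0 then [] else odd n # binary_digits (n div 2))"

declare binary_digits.simps [simp del]

definition encode_int :: "int \<Rightarrow> data" where
  "encode_int k =
     Node (encode_bool (k < 0)) (encode_list encode_bool (binary_digits (nat \<bar>k\<bar>)))"

definition encode_instance :: "eds_instance \<Rightarrow> data" where
  "encode_instance I =
     (let vs = [0..<card (verts (graph I))]
      in Node (encode_list (encode_list encode_bool)
                 (map (\<lambda>u. map (\<lambda>v. {u, v} \<in> edges (graph I)) vs) vs))
           (Node (encode_list encode_bool (map (\<lambda>v. v \<in> modulator I) vs))
             (encode_int (budget I))))"

definition eds_kernelization :: "(eds_instance \<Rightarrow> eds_instance) \<Rightarrow> bool" where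
  "eds_kernelization K \<longleftrightarrow>
     polytime_on encode_instance eds_instances K \<and>
     (\<forall>I\<in>eds_instances. K I \<in> eds_instances \<and> (eds_yes (K I) \<longleftrightarrow> eds_yes I)) \<and>
     (\<exists>h. computable h \<and>
        (\<forall>I\<in>eds_instances. size (encode_instance (K I)) \<le> h (parameter I)))"

end

theory Submission
  imports Defs
begin

text \<open>
  Link a component \<open>v\<^sub>1 v\<^sub>2 v\<^sub>3 v\<^sub>4 v\<^sub>5\<close> of \<open>G - X\<close> to the vertices of \<open>X\<close> adjacent to one of its four
  vertices other than \<open>v\<^sub>3\<close>. Every solution has two edges at these four vertices. Conversely, two
  edges suffice to cover \<open>v\<^sub>3\<close> and one linked vertex of \<open>X\<close> and to dominate the path. So if a set
  \<open>D \<subseteq> X\<close> is matched into a set \<open>C\<close> of components that are linked only to vertices of \<open>D\<close>, then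
  \<open>D\<close> and \<open>C\<close> can be deleted while the budget decreases by \<open>2 |C|\<close>.

  A suitable pair is found by an auction: a component without a vertex buys a cheapest linked
  vertex, whose price goes up by one, as long as that price is at most the number \<open>n\<close> of vertices
  of \<open>G\<close>. At the end some price \<open>g \<le> n\<close> does not occur in \<open>X\<close>. A vertex priced above \<open>g\<close> is owned by a component all of whose linked
  vertices are priced above \<open>g\<close>, and the same holds for the components that own nothing. Hence
  the vertices priced above \<open>g\<close> can be taken as \<open>D\<close>, and the components that do not own a vertex
  priced below \<open>g\<close> as \<open>C\<close>. Each remaining component owns a remaining vertex of \<open>X\<close>, so at most
  \<open>6 |X|\<close> vertices are left.
\<close>

section \<open>Polynomial-time functions\<close>

text \<open>The third vertex is exempt from the links because it is covered at no extra cost: the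
  two edges spent on a removed path always include it, so all its edges into \<open>X\<close> are
  dominated. Two edges cannot cover the other four vertices as well, so the neighbours of these in
  \<open>X\<close> have to disappear too; the pair is the analogue of a crown for Vertex Cover.

  Prices replace a search for augmenting paths. Their cutoff fits the pigeonhole principle: the
  values 0, ..., n cannot all be prices of at most n modulator vertices, while a component that owns
  nothing at the end sees only prices above n.

  The algorithm must be a WHILE program with a polynomial time bound. Therefore working numbers are
  unary, and a number of rounds fixed in advance replaces a termination test. The budget is binary
  and may be exponential; it is cut down to n at once, which preserves the answer because some edge
  dominating set has at most n edges.\<close>

lemma poly_nat_mono: "m \<le> n \<Longrightarrow> poly (p :: nat poly) m \<le> poly p n"
  by (induction p) (auto intro!: add_mono mult_mono)

text \<open>A common coding for all intermediate data, so that closure properties can be stated for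
  HOL functions between arbitrary coded types rather than for programs.\<close>

class encodable =
  fixes enc :: "'a \<Rightarrow> data"

instantiation unit :: encodable begin
definition "enc_unit (_ :: unit) = Leaf"
instance ..
end

instantiation bool :: encodable begin
definition "enc_bool = encode_bool"
instance ..
end

instantiation nat :: encodable begin
definition "enc_nat = encode_unary"
instance ..
end

instantiation list :: (encodable) encodable begin
definition "enc_list = encode_list enc"
instance ..
end

instantiation prod :: (encodable, encodable) encodable begin
definition "enc_prod = (\<lambda>(a, b). Node (enc a) (enc b))"
instance ..
end

lemma enc_simps [simp]:
  "enc () = Leaf"
  "enc True = Node Leaf Leaf" "enc False = Leaf"
  "enc (0 :: nat) = Leaf" "enc (Suc n) = Node Leaf (enc n)"
  "enc [] = Leaf" "enc (x # xs) = Node (enc x) (enc xs)"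
  "enc (a, b) = Node (enc a) (enc b)"
  by (simp_all add: enc_unit_def enc_bool_def encode_bool_def enc_nat_def encode_unary_def
      enc_list_def enc_prod_def)

lemma size_enc_bool: "size (enc (b :: bool)) \<le> 1"
  by (cases b) auto

lemma size_enc_nat [simp]: "size (enc (n :: nat)) = n"
  by (induction n) auto

lemma length_le_size_enc: "length xs \<le> size (enc xs)"
  by (induction xs) auto

lemma size_enc_member: "x \<in> set xs \<Longrightarrow> size (enc x) \<le> size (enc xs)"
  by (induction xs) auto

lemma size_enc_list_le:
  "(\<And>x. x \<in> set xs \<Longrightarrow> size (enc x) \<le> B) \<Longrightarrow> size (enc xs) \<le> length xs * Suc B"
proof (induction xs)
  case (Cons x xs)
  have "size (enc x) \<le> B" "size (enc xs) \<le> length xs * Suc B"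
    using Cons by simp_all
  then show ?case by simp
qed simp

text \<open>A unary number and a list of units of that length have the same code, so repeating
  something n times is a fold over a list and needs no conversion.\<close>

lemma enc_replicate_unit: "enc (replicate n ()) = enc n"
  by (induction n) auto

text \<open>An upper bound in place of the exact time of \<open>exec\<close> can be weakened, so
  bounds compose without exact counting.\<close>

definition runs :: "cmd \<Rightarrow> data \<Rightarrow> data \<Rightarrow> nat \<Rightarrow> bool" where
  "runs c x y T \<longleftrightarrow> (\<exists>t\<le>T. exec c x y t)"

lemma runs_mono: "runs c x y S \<Longrightarrow> S \<le> T \<Longrightarrow> runs c x y T"
  unfolding runs_def by (meson le_trans)

lemma runs_Assign: "y = eval_expr e x \<Longrightarrow> 1 + cost e \<le> T \<Longrightarrow> runs (Assign e) x y T"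
  unfolding runs_def using exec_Assign by blast

lemma runs_Seq: "runs c x y S \<Longrightarrow> runs d y z T \<Longrightarrow> runs (Seq c d) x z (S + T)"
  unfolding runs_def using exec_Seq add_le_mono by metis

lemma runs_While_stop: "eval_expr e x = Leaf \<Longrightarrow> 1 + cost e \<le> T \<Longrightarrow> runs (While e c) x x T"
  unfolding runs_def using exec_While_stop by blast

lemma runs_While_step:
  assumes "eval_expr e x \<noteq> Leaf" "runs c x y S" "runs (While e c) y z T"
  shows "runs (While e c) x z (1 + cost e + S + T)"
proof -
  obtain s t where "s \<le> S" "exec c x y s" "t \<le> T" "exec (While e c) y z t"
    using assms unfolding runs_def by blast
  then show ?thesis
    using exec_While_step[OF assms(1)] unfolding runs_def by (meson add_le_mono le_refl)
qed

section \<open>Combining programs that share a single variable\<close>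

primrec left_expr :: "expr \<Rightarrow> expr" where
  "left_expr Var = Left Var"
| "left_expr Empty = Empty"
| "left_expr (Pair a b) = Pair (left_expr a) (left_expr b)"
| "left_expr (Left a) = Left (left_expr a)"
| "left_expr (Right a) = Right (left_expr a)"

text \<open>With only one variable, data that must survive a subprogram are parked in the right
  child of the store while the subprogram works on the left child.\<close>

primrec left_cmd :: "cmd \<Rightarrow> cmd" where
  "left_cmd (Assign e) = Assign (Pair (left_expr e) (Right Var))"
| "left_cmd (Seq c d) = Seq (left_cmd c) (left_cmd d)"
| "left_cmd (While e c) = While (left_expr e) (left_cmd c)"

lemma eval_left_expr [simp]: "eval_expr (left_expr e) (Node x r) = eval_expr e x"
  by (induction e) auto

lemma cost_left_expr: "cost (left_expr e) \<le> 2 * cost e"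
  by (induction e) auto

lemma cost_pos: "0 < cost e"
  by (induction e) auto

text \<open>Reading the variable becomes \<open>Left Var\<close>, which at most doubles the cost of
  an expression, and an assignment rebuilds the pair at constant cost. The factor 5 absorbs
  both.\<close>

lemma exec_left_cmd: "exec c x y t \<Longrightarrow> runs (left_cmd c) (Node x r) (Node y r) (5 * t)"
proof (induction rule: exec.induct)
  case (exec_Assign e x)
  show ?case
    using cost_left_expr[of e] cost_pos[of e] by (auto intro!: runs_Assign)
next
  case (exec_Seq c x y s d z t)
  then have "runs (left_cmd (Seq c d)) (Node x r) (Node z r) (5 * s + 5 * t)"
    by (auto intro: runs_Seq)
  then show ?case by (simp add: algebra_simps)
next
  case (exec_While_stop e x c)
  then show ?case
    using cost_left_expr[of e] cost_pos[of e] by (auto intro!: runs_While_stop)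
next
  case (exec_While_step e x c y s z t)
  then have "runs (left_cmd (While e c)) (Node x r) (Node z r) (1 + cost (left_expr e) + 5 * s + 5 * t)"
    using runs_While_step[of "left_expr e" "Node x r"] by simp
  then show ?case
    by (rule runs_mono) (use cost_left_expr[of e] cost_pos[of e] in simp)
qed

lemma runs_left_cmd: "runs c x y T \<Longrightarrow> runs (left_cmd c) (Node x r) (Node y r) (5 * T)"
  unfolding runs_def[of c] by (auto intro: runs_mono[OF exec_left_cmd])

text \<open>Two flags, the second one initially set, make the two loops run at most once in total.\<close>

definition branch :: "expr \<Rightarrow> cmd \<Rightarrow> cmd \<Rightarrow> cmd" where
  "branch e c d =
    Seq (Assign (Pair Var (Pair e (Pair Empty Empty))))
   (Seq (While (Left (Right Var)) (Seq (left_cmd c) (Assign (Pair (Left Var) (Pair Empty Empty)))))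
   (Seq (While (Right (Right Var)) (Seq (left_cmd d) (Assign (Pair (Left Var) (Pair Empty Empty)))))
        (Assign (Left Var))))"

lemma runs_branch:
  assumes "runs (if eval_expr e x \<noteq> Leaf then c else d) x y T"
  shows "runs (branch e c d) x y (5 * T + cost e + 40)"
proof -
  define st where "st = Node x (Node (eval_expr e x) (Node Leaf Leaf))"
  have init: "runs (Assign (Pair Var (Pair e (Pair Empty Empty)))) x st (cost e + 8)"
    by (rule runs_Assign) (auto simp: st_def)
  have fin: "runs (Assign (Left Var)) (Node y r) y 3" for r
    by (rule runs_Assign) auto
  let ?off = "Node y (Node Leaf Leaf)"
  have clear: "runs (Assign (Pair (Left Var) (Pair Empty Empty))) (Node y r) ?off 7" for r
    by (rule runs_Assign) auto
  show ?thesis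
  proof (cases "eval_expr e x = Leaf")
    case False
    then have c: "runs c x y T" using assms by simp
    have 1: "runs (While (Left (Right Var)) (Seq (left_cmd c) (Assign (Pair (Left Var) (Pair Empty Empty)))))
        st ?off (1 + cost (Left (Right Var)) + (5 * T + 7) + 4)"
      by (rule runs_While_step, simp add: st_def False, unfold st_def,
          rule runs_Seq[OF runs_left_cmd[OF c] clear], rule runs_While_stop) auto
    have 2: "runs (While (Right (Right Var)) (Seq (left_cmd d) (Assign (Pair (Left Var) (Pair Empty Empty)))))
        ?off ?off 4"
      by (rule runs_While_stop) auto
    show ?thesis
      unfolding branch_def
      by (rule runs_mono[OF runs_Seq[OF init runs_Seq[OF 1 runs_Seq[OF 2 fin]]]]) simp
  next
    case True
    then have d: "runs d x y T" using assms by simp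
    have 1: "runs (While (Left (Right Var)) (Seq (left_cmd c) (Assign (Pair (Left Var) (Pair Empty Empty)))))
        st st 4"
      by (rule runs_While_stop) (auto simp: st_def True)
    have 2: "runs (While (Right (Right Var)) (Seq (left_cmd d) (Assign (Pair (Left Var) (Pair Empty Empty)))))
        st ?off (1 + cost (Right (Right Var)) + (5 * T + 7) + 4)"
      by (rule runs_While_step, simp add: st_def, unfold st_def,
          rule runs_Seq[OF runs_left_cmd[OF d] clear], rule runs_While_stop) auto
    show ?thesis
      unfolding branch_def
      by (rule runs_mono[OF runs_Seq[OF init runs_Seq[OF 1 runs_Seq[OF 2 fin]]]]) simp
  qed
qed

text \<open>
  The bound on the size of the result is not implied by the bound on the time, because copying a
  tree costs one unit; without it polynomial-time functions would not be closed under composition.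
\<close>

definition ptime :: "('a :: encodable \<Rightarrow> 'b :: encodable) \<Rightarrow> bool" where
  "ptime f \<longleftrightarrow> (\<exists>c p. \<forall>a. runs c (enc a) (enc (f a)) (poly p (size (enc a))) \<and>
     size (enc (f a)) \<le> poly p (size (enc a)))"

lemma ptimeI:
  assumes "\<And>a. runs c (enc a) (enc (f a)) (poly p (size (enc a)))"
    and "\<And>a. size (enc (f a)) \<le> poly q (size (enc a))"
  shows "ptime f"
  unfolding ptime_def
proof (intro exI allI conjI)
  fix a
  show "runs c (enc a) (enc (f a)) (poly (p + q) (size (enc a)))"
    using assms(1) by (rule runs_mono) simp
  show "size (enc (f a)) \<le> poly (p + q) (size (enc a))"
    using assms(2)[of a] by simp
qed

text \<open>A single assignment takes constant time because \<open>cost\<close> does not depend on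
  the store.\<close>

lemma ptime_expr:
  assumes "\<And>a. enc (f a) = eval_expr e (enc a)" and "\<And>a. size (enc (f a)) \<le> size (enc a) + k"
  shows "ptime f"
proof (rule ptimeI)
  show "runs (Assign e) (enc a) (enc (f a)) (poly [:1 + cost e:] (size (enc a)))" for a
    by (rule runs_Assign) (simp_all add: assms(1))
  show "size (enc (f a)) \<le> poly [:k, 1:] (size (enc a))" for a
    using assms(2)[of a] by simp
qed

lemma ptime_id: "ptime (\<lambda>x. x)"
  by (rule ptime_expr[where e = Var and k = 0]) auto

primrec constant_expr :: "data \<Rightarrow> expr" where
  "constant_expr Leaf = Empty"
| "constant_expr (Node l r) = Pair (constant_expr l) (constant_expr r)"

lemma ptime_const: "ptime (\<lambda>x :: 'a :: encodable. k)"
proof (rule ptime_expr)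
  have "eval_expr (constant_expr d) x = d" for d x
    by (induction d) auto
  then show "enc k = eval_expr (constant_expr (enc k)) (enc a)" for a :: 'a
    by simp
  show "size (enc k) \<le> size (enc a) + size (enc k)" for a :: 'a
    by simp
qed

lemma ptime_comp:
  assumes "ptime f" "ptime g"
  shows "ptime (\<lambda>x. f (g x))"
proof -
  obtain c p where c: "\<And>a. runs c (enc a) (enc (f a)) (poly p (size (enc a)))"
    and p: "\<And>a. size (enc (f a)) \<le> poly p (size (enc a))"
    using assms(1) unfolding ptime_def by blast
  obtain d q where d: "\<And>a. runs d (enc a) (enc (g a)) (poly q (size (enc a)))"
    and q: "\<And>a. size (enc (g a)) \<le> poly q (size (enc a))"
    using assms(2) unfolding ptime_def by blast
  show ?thesis
  proof (rule ptimeI)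
    fix a
    show "runs (Seq d c) (enc a) (enc (f (g a))) (poly (q + pcompose p q) (size (enc a)))"
      using poly_nat_mono[OF q[of a], of p]
      by (intro runs_mono[OF runs_Seq[OF d[of a] c]]) (simp add: poly_pcompose)
    show "size (enc (f (g a))) \<le> poly (pcompose p q) (size (enc a))"
      using p[of "g a"] poly_nat_mono[OF q[of a], of p] by (simp add: poly_pcompose)
  qed
qed

lemma ptime_fst: "ptime f \<Longrightarrow> ptime (\<lambda>x. fst (f x))"
  by (rule ptime_comp[of fst]) (rule ptime_expr[where e = "Left Var" and k = 0], auto)

lemma ptime_snd: "ptime f \<Longrightarrow> ptime (\<lambda>x. snd (f x))"
  by (rule ptime_comp[of snd]) (rule ptime_expr[where e = "Right Var" and k = 0], auto)

lemma ptime_Suc: "ptime f \<Longrightarrow> ptime (\<lambda>x. Suc (f x))"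
  by (rule ptime_comp[of Suc]) (rule ptime_expr[where e = "Pair Empty Var" and k = 1], auto)

lemma ptime_pred: "ptime f \<Longrightarrow> ptime (\<lambda>x. f x - Suc 0)"
proof (rule ptime_comp[of "\<lambda>n. n - Suc 0"])
  have "enc (n - Suc 0) = eval_expr (Right Var) (enc n)" for n
    by (cases n) auto
  then show "ptime (\<lambda>n. n - Suc 0)"
    by (rule ptime_expr[where k = 0]) simp
qed

lemma ptime_tl: "ptime f \<Longrightarrow> ptime (\<lambda>x. tl (f x))"
proof (rule ptime_comp[of tl])
  have "enc (tl xs) = eval_expr (Right Var) (enc xs)" "size (enc (tl xs)) \<le> size (enc xs)" for xs :: "'b list"
    by (cases xs; simp)+
  then show "ptime (tl :: 'b list \<Rightarrow> _)"
    by (intro ptime_expr[where e = "Right Var" and k = 0]) auto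
qed

lemma ptime_replicate_unit: "ptime f \<Longrightarrow> ptime (\<lambda>x. replicate (f x) ())"
  by (rule ptime_comp[of "\<lambda>n. replicate n ()"])
    (rule ptime_expr[where e = Var and k = 0], auto simp: enc_replicate_unit)

text \<open>The argument is duplicated; one copy is processed on the left while the other waits on
  the right, then the two are swapped and the other copy is processed. The second swap restores the
  order.\<close>

lemma ptime_Pair:
  fixes f :: "'a :: encodable \<Rightarrow> 'b :: encodable" and g :: "'a \<Rightarrow> 'c :: encodable"
  assumes "ptime f" "ptime g"
  shows "ptime (\<lambda>x. (f x, g x))"
proof -
  obtain c p where c: "\<And>a. runs c (enc a) (enc (f a)) (poly p (size (enc a)))"
    and p: "\<And>a. size (enc (f a)) \<le> poly p (size (enc a))"
    using assms(1) unfolding ptime_def by blast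
  obtain d q where d: "\<And>a. runs d (enc a) (enc (g a)) (poly q (size (enc a)))"
    and q: "\<And>a. size (enc (g a)) \<le> poly q (size (enc a))"
    using assms(2) unfolding ptime_def by blast
  let ?swap = "Assign (Pair (Right Var) (Left Var))"
  show ?thesis
  proof (rule ptimeI)
    fix a :: 'a
    have dup: "runs (Assign (Pair Var Var)) (enc a) (Node (enc a) (enc a)) 4"
      by (rule runs_Assign) auto
    have swap: "runs ?swap (Node x y) (Node y x) 6" for x y
      by (rule runs_Assign) auto
    show "runs (Seq (Assign (Pair Var Var)) (Seq (left_cmd c) (Seq ?swap (Seq (left_cmd d) ?swap))))
        (enc a) (enc (f a, g a)) (poly (smult 5 p + smult 5 q + [:16:]) (size (enc a)))"
      unfolding enc_simps
      by (rule runs_mono[OF runs_Seq[OF dup runs_Seq[OF runs_left_cmd[OF c] runs_Seq[OF swap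
          runs_Seq[OF runs_left_cmd[OF d] swap]]]]]) simp
    show "size (enc (f a, g a)) \<le> poly (p + q + [:1:]) (size (enc a))"
      using p[of a] q[of a] by simp
  qed
qed

lemma ptime_Cons:
  assumes "ptime f" "ptime g"
  shows "ptime (\<lambda>x. f x # g x)"
proof -
  have "ptime (\<lambda>p. fst p # snd p)"
    by (rule ptime_expr[where e = "Var" and k = 0]) auto
  from ptime_comp[OF this ptime_Pair[OF assms]] show ?thesis by simp
qed

text \<open>The branch with bound variables is required to be polynomial in the nested pair of its
  free and bound variables. All rules for terms under binders have this uncurried form.\<close>

lemma ptime_case_list:
  fixes l :: "'a :: encodable \<Rightarrow> 'b :: encodable list" and g :: "'a \<Rightarrow> 'c :: encodable"
  assumes "ptime l" "ptime g" "ptime (\<lambda>p. f (fst p) (fst (snd p)) (snd (snd p)))"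
  shows "ptime (\<lambda>x. case l x of [] \<Rightarrow> g x | y # ys \<Rightarrow> f x y ys)"
proof -
  let ?r = "\<lambda>(x, ys). case ys of [] \<Rightarrow> g x | y # ys \<Rightarrow> f x y ys"
  let ?f = "\<lambda>p. f (fst p) (fst (snd p)) (snd (snd p))"
  obtain c p where c: "\<And>a. runs c (enc a) (enc (?f a)) (poly p (size (enc a)))"
    and p: "\<And>a. size (enc (?f a)) \<le> poly p (size (enc a))"
    using assms(3) unfolding ptime_def by blast
  have "ptime (\<lambda>a :: 'a \<times> 'b list. g (fst a))"
    by (intro ptime_comp[OF assms(2)] ptime_fst ptime_id)
  then obtain d q where d: "\<And>a :: 'a \<times> 'b list. runs d (enc a) (enc (g (fst a))) (poly q (size (enc a)))"
    and q: "\<And>a :: 'a \<times> 'b list. size (enc (g (fst a))) \<le> poly q (size (enc a))"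
    unfolding ptime_def by blast
  have "ptime ?r"
  proof (rule ptimeI)
    fix a :: "'a \<times> 'b list"
    obtain x ys where a: "a = (x, ys)" by (cases a)
    show "runs (branch (Right Var) c d) (enc a) (enc (?r a))
        (poly (smult 5 (p + q) + [:42:]) (size (enc a)))"
    proof (cases ys)
      case Nil
      have "runs d (enc a) (enc (?r a)) (poly q (size (enc a)))"
        using d[of a] by (simp add: a Nil)
      then show ?thesis
        by (intro runs_mono[OF runs_branch[where T = "poly q (size (enc a))"]]) (simp_all add: a Nil)
    next
      \<comment> \<open>The codes of \<open>(x, y # zs)\<close> and \<open>(x, y, zs)\<close> are
        the same tree, so the program for this branch runs on the store as it is.\<close>
      case (Cons y zs)
      have "runs c (enc a) (enc (?r a)) (poly p (size (enc a)))"
        using c[of "(x, y, zs)"] by (simp add: a Cons)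
      then show ?thesis
        by (intro runs_mono[OF runs_branch[where T = "poly p (size (enc a))"]]) (simp_all add: a Cons)
    qed
    show "size (enc (?r a)) \<le> poly (p + q) (size (enc a))"
      using p[of "(x, hd ys, tl ys)"] q[of a] by (cases ys) (auto simp: a)
  qed
  from ptime_comp[OF this ptime_Pair[OF ptime_id assms(1)]] show ?thesis by simp
qed

text \<open>A truth value has the code of a list of units of length at most one, so this is a case
  distinction on lists.\<close>

lemma ptime_If:
  assumes "ptime b" "ptime f" "ptime g"
  shows "ptime (\<lambda>x. if b x then f x else g x)"
proof -
  have "ptime (\<lambda>b. if b then [()] else [])"
  proof (rule ptime_expr)
    show "enc (if b then [()] else []) = eval_expr Var (enc b)" for b by simp
    show "size (enc (if b then [()] else [])) \<le> size (enc b) + 0" for b by simp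
  qed
  from ptime_case_list[OF ptime_comp[OF this assms(1)] assms(3) ptime_comp[OF assms(2) ptime_fst[OF ptime_id]]]
  have "ptime (\<lambda>x. case if b x then [()] else [] of [] \<Rightarrow> g x | _ # _ \<Rightarrow> f x)" .
  moreover have "(\<lambda>x. case if b x then [()] else [] of [] \<Rightarrow> g x | _ # _ \<Rightarrow> f x)
      = (\<lambda>x. if b x then f x else g x)"
    by auto
  ultimately show ?thesis by simp
qed

text \<open>The store holds accumulator, remaining list and parameter as \<open>(s, l, a)\<close>. A
  round turns \<open>(s, b # l, a)\<close> into \<open>((a, s, b), l, a)\<close> and lets
  \<open>c\<close> replace the triple by the next accumulator.\<close>

definition fold_cmd :: "cmd \<Rightarrow> cmd" where
  "fold_cmd c = While (Left (Right Var))
    (Seq (Assign (Pair (Pair (Right (Right Var)) (Pair (Left Var) (Left (Left (Right Var)))))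
                   (Pair (Right (Left (Right Var))) (Right (Right Var)))))
         (left_cmd c))"

lemma runs_fold_cmd:
  fixes g :: "'b :: encodable \<Rightarrow> 'c :: encodable \<Rightarrow> 'b"
  assumes "\<And>i. i < length l \<Longrightarrow> runs c (enc (a, foldl g s (take i l), l ! i))
    (enc (foldl g s (take (Suc i) l))) T"
  shows "runs (fold_cmd c) (enc (s, l, a)) (enc (foldl g s l, [] :: 'c list, a))
    (4 + length l * (5 * T + 30))"
  using assms
proof (induction l arbitrary: s)
  case Nil
  show ?case unfolding fold_cmd_def by (auto intro!: runs_While_stop)
next
  case (Cons b l)
  let ?s = "g s b"
  have "runs c (enc (a, s, b)) (enc ?s) T"
    using Cons.prems[of 0] by simp
  from runs_left_cmd[OF this, of "enc (l, a)"]
  have 2: "runs (left_cmd c) (enc ((a, s, b), l, a)) (enc (?s, l, a)) (5 * T)"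
    by simp
  have 1: "runs (Assign (Pair (Pair (Right (Right Var)) (Pair (Left Var) (Left (Left (Right Var)))))
      (Pair (Right (Left (Right Var))) (Right (Right Var))))) (enc (s, b # l, a)) (enc ((a, s, b), l, a)) 26"
    by (rule runs_Assign) auto
  have 3: "runs (fold_cmd c) (enc (?s, l, a)) (enc (foldl g ?s l, [] :: 'c list, a))
      (4 + length l * (5 * T + 30))"
  proof (rule Cons.IH)
    fix i assume "i < length l"
    then show "runs c (enc (a, foldl g ?s (take i l), l ! i)) (enc (foldl g ?s (take (Suc i) l))) T"
      using Cons.prems[of "Suc i"] by simp
  qed
  have "runs (fold_cmd c) (enc (s, b # l, a)) (enc (foldl g ?s l, [] :: 'c list, a))
      (1 + cost (Left (Right Var)) + (26 + 5 * T) + (4 + length l * (5 * T + 30)))"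
    unfolding fold_cmd_def
    by (rule runs_While_step[OF _ runs_Seq[OF 1 2] 3[unfolded fold_cmd_def]]) simp
  then show ?case
    by (simp add: algebra_simps)
qed

text \<open>A polynomial step alone is not enough, since squaring the size in each round would be
  exponential overall. Hence the bound on all intermediate accumulators.\<close>

lemma ptime_foldl_bounded:
  fixes g :: "'a :: encodable \<Rightarrow> 'b :: encodable \<Rightarrow> 'c :: encodable \<Rightarrow> 'b"
  assumes step: "ptime (\<lambda>p. g (fst p) (fst (snd p)) (snd (snd p)))"
    and init: "ptime s" and list: "ptime l"
    and bound: "\<And>a i. i \<le> length (l a) \<Longrightarrow>
      size (enc (foldl (g a) (s a) (take i (l a)))) \<le> poly r (size (enc a))"
  shows "ptime (\<lambda>a. foldl (g a) (s a) (l a))"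
proof -
  let ?g = "\<lambda>p. g (fst p) (fst (snd p)) (snd (snd p))"
  obtain c p where c: "\<And>a. runs c (enc a) (enc (?g a)) (poly p (size (enc a)))"
    using step unfolding ptime_def by blast
  obtain d q where d: "\<And>a. runs d (enc a) (enc (s a, l a, a)) (poly q (size (enc a)))"
    and q: "\<And>a. size (enc (s a, l a, a)) \<le> poly q (size (enc a))"
    using ptime_Pair[OF init ptime_Pair[OF list ptime_id]] unfolding ptime_def by blast
  have l: "size (enc (l a)) \<le> poly q (size (enc a))" for a
    using q[of a] by simp
  \<comment> \<open>The step is run on a triple, whose size is that of the parameter, of the
    accumulator (bounded by \<open>r\<close>) and of a list element (bounded by \<open>q\<close>),
    plus two for the pairing nodes.\<close>
  define t where "t = pcompose p ([:2, 1:] + r + q)"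
  show ?thesis
  proof (rule ptimeI)
    fix a
    have 1: "runs (fold_cmd c) (enc (s a, l a, a)) (enc (foldl (g a) (s a) (l a), [] :: 'c list, a))
        (4 + length (l a) * (5 * poly t (size (enc a)) + 30))"
    proof (rule runs_fold_cmd)
      fix i assume i: "i < length (l a)"
      let ?x = "(a, foldl (g a) (s a) (take i (l a)), l a ! i)"
      have eq: "?g ?x = foldl (g a) (s a) (take (Suc i) (l a))"
        using i by (simp add: take_Suc_conv_app_nth)
      have "poly p (size (enc ?x)) \<le> poly t (size (enc a))"
        unfolding t_def poly_pcompose
        by (rule poly_nat_mono)
          (use bound[of i a] i l[of a] size_enc_member[OF nth_mem[OF i]] in simp)
      from runs_mono[OF c this]
      show "runs c (enc ?x) (enc (foldl (g a) (s a) (take (Suc i) (l a)))) (poly t (size (enc a)))"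
        unfolding eq .
    qed
    have 2: "runs (Assign (Left Var)) (enc (foldl (g a) (s a) (l a), [] :: 'c list, a)) (enc (foldl (g a) (s a) (l a))) 3"
      by (rule runs_Assign) auto
    have "length (l a) * (5 * poly t (size (enc a)) + 30) \<le> poly q (size (enc a)) * (5 * poly t (size (enc a)) + 30)"
      using length_le_size_enc[of "l a"] l[of a] by (intro mult_le_mono1) linarith
    then show "runs (Seq d (Seq (fold_cmd c) (Assign (Left Var)))) (enc a) (enc (foldl (g a) (s a) (l a)))
        (poly (q + [:7:] + q * (smult 5 t + [:30:])) (size (enc a)))"
      by (intro runs_mono[OF runs_Seq[OF d runs_Seq[OF 1 2]]]) (simp add: algebra_simps)
    show "size (enc (foldl (g a) (s a) (l a))) \<le> poly r (size (enc a))"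
      using bound[of "length (l a)" a] by simp
  qed
qed

lemma size_foldl_additive:
  assumes "\<And>s b. b \<in> set l \<Longrightarrow> size (enc (g s b)) \<le> size (enc s) + B"
  shows "size (enc (foldl g s l)) \<le> size (enc s) + length l * B"
  using assms
proof (induction l arbitrary: s)
  case (Cons b l)
  have "size (enc (foldl g (g s b) l)) \<le> size (enc (g s b)) + length l * B"
    using Cons by simp
  then show ?case using Cons.prems[of b s] by simp
qed simp

text \<open>If a round adds an amount that does not depend on the accumulator, the sizes grow at
  most linearly in the number of rounds.\<close>

lemma ptime_foldl:
  fixes g :: "'a :: encodable \<Rightarrow> 'b :: encodable \<Rightarrow> 'c :: encodable \<Rightarrow> 'b"
  assumes step: "ptime (\<lambda>p. g (fst p) (fst (snd p)) (snd (snd p)))"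
    and init: "ptime s" and list: "ptime l"
    and growth: "\<And>a s b. size (enc (g a s b)) \<le> size (enc s) + poly r (size (enc a) + size (enc b))"
  shows "ptime (\<lambda>a. foldl (g a) (s a) (l a))"
proof -
  obtain p where p: "\<And>a. size (enc (s a, l a)) \<le> poly p (size (enc a))"
    using ptime_Pair[OF init list] unfolding ptime_def by blast
  show ?thesis
  proof (rule ptime_foldl_bounded[OF step init list])
    fix a :: 'a and i :: nat
    define B where "B = poly r (size (enc a) + poly p (size (enc a)))"
    have l: "size (enc (l a)) \<le> poly p (size (enc a))"
      using p[of a] by simp
    have "size (enc (foldl (g a) (s a) (take i (l a)))) \<le> size (enc (s a)) + length (take i (l a)) * B"
    proof (rule size_foldl_additive)
      fix s b assume "b \<in> set (take i (l a))"
      then have "size (enc b) \<le> poly p (size (enc a))"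
        using size_enc_member[of b "l a"] l by (meson in_set_takeD le_trans)
      then have "poly r (size (enc a) + size (enc b)) \<le> B"
        unfolding B_def by (intro poly_nat_mono) simp
      then show "size (enc (g a s b)) \<le> size (enc s) + B"
        using growth[of a s b] by simp
    qed
    also have "\<dots> \<le> poly p (size (enc a)) + poly p (size (enc a)) * B"
      using p[of a] length_le_size_enc[of "l a"] by (intro add_mono mult_le_mono1) (auto simp: min_def)
    finally show "size (enc (foldl (g a) (s a) (take i (l a))))
        \<le> poly (p + p * pcompose r ([:0, 1:] + p)) (size (enc a))"
      by (simp add: B_def poly_pcompose)
  qed
qed

section \<open>Closure under connectives, list functions and unary arithmetic\<close>

named_theorems ptime_intros

declare ptime_const [ptime_intros] ptime_id [ptime_intros] ptime_fst [ptime_intros]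
  ptime_snd [ptime_intros] ptime_Pair [ptime_intros] ptime_Suc [ptime_intros]
  ptime_pred [ptime_intros] ptime_tl [ptime_intros] ptime_Cons [ptime_intros]
  ptime_case_list [ptime_intros] ptime_If [ptime_intros]
  ptime_replicate_unit [ptime_intros]

lemma ptime_conj [ptime_intros]: "ptime P \<Longrightarrow> ptime Q \<Longrightarrow> ptime (\<lambda>x. P x \<and> Q x)"
proof -
  assume "ptime P" "ptime Q"
  then have "ptime (\<lambda>x. if P x then Q x else False)"
    by (intro ptime_If ptime_const)
  moreover have "(\<lambda>x. if P x then Q x else False) = (\<lambda>x. P x \<and> Q x)"
    by auto
  ultimately show ?thesis by simp
qed

lemma ptime_not [ptime_intros]: "ptime P \<Longrightarrow> ptime (\<lambda>x. \<not> P x)"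
proof -
  assume "ptime P"
  then have "ptime (\<lambda>x. if P x then False else True)"
    by (intro ptime_If ptime_const)
  moreover have "(\<lambda>x. if P x then False else True) = (\<lambda>x. \<not> P x)"
    by auto
  ultimately show ?thesis by simp
qed

lemma ptime_disj [ptime_intros]: "ptime P \<Longrightarrow> ptime Q \<Longrightarrow> ptime (\<lambda>x. P x \<or> Q x)"
proof -
  assume "ptime P" "ptime Q"
  then have "ptime (\<lambda>x. \<not> (\<not> P x \<and> \<not> Q x))"
    by (intro ptime_not ptime_conj)
  then show ?thesis by simp
qed

lemma ptime_imp [ptime_intros]: "ptime P \<Longrightarrow> ptime Q \<Longrightarrow> ptime (\<lambda>x. P x \<longrightarrow> Q x)"
  unfolding imp_conv_disj by (intro ptime_disj ptime_not)

lemma ptime_rev [ptime_intros]: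
  assumes "ptime l"
  shows "ptime (\<lambda>x. rev (l x))"
proof -
  have "ptime (\<lambda>x. foldl (\<lambda>s b. b # s) [] (l x))"
    by (rule ptime_foldl[where r = "[:1, 1:]"]) (intro ptime_intros assms | simp)+
  moreover have "foldl (\<lambda>s b. b # s) [] xs = rev xs" for xs :: "'b list"
    by (simp add: foldl_conv_fold rev_conv_fold fun_eq_iff)
  ultimately show ?thesis by simp
qed

lemma ptime_append [ptime_intros]:
  assumes "ptime l" "ptime m"
  shows "ptime (\<lambda>x. l x @ m x)"
proof -
  have "ptime (\<lambda>x. foldl (\<lambda>s b. b # s) (m x) (rev (l x)))"
    by (rule ptime_foldl[where r = "[:1, 1:]"]) (intro ptime_intros assms | simp)+
  moreover have "foldl (\<lambda>s b. b # s) ys (rev xs) = xs @ ys" for xs ys :: "'b list"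
    by (induction xs) auto
  ultimately show ?thesis by simp
qed

lemma ptime_map [ptime_intros]:
  assumes "ptime (\<lambda>p. f (fst p) (snd p))" "ptime l"
  shows "ptime (\<lambda>x. map (f x) (l x))"
proof -
  obtain p where p: "\<And>a. size (enc (f (fst a) (snd a))) \<le> poly p (size (enc a))"
    using assms(1) unfolding ptime_def by blast
  have "ptime (\<lambda>x. foldl (\<lambda>s b. f x b # s) [] (l x))"
  proof (rule ptime_foldl[where r = "[:1:] + pcompose p [:1, 1:]"])
    show "ptime (\<lambda>p. f (fst p) (snd (snd p)) # fst (snd p))"
      using ptime_comp[OF assms(1) ptime_Pair[OF ptime_fst[OF ptime_id] ptime_snd[OF ptime_snd[OF ptime_id]]]]
      by (intro ptime_intros) simp
    show "size (enc (f a b # s)) \<le> size (enc s) + poly ([:1:] + pcompose p [:1, 1:]) (size (enc a) + size (enc b))"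
      for a s b
      using p[of "(a, b)"] by (simp add: poly_pcompose add.commute)
  qed (intro ptime_intros assms)+
  from ptime_rev[OF this] have "ptime (\<lambda>x. rev (foldl (\<lambda>s b. f x b # s) [] (l x)))" .
  moreover have "foldl (\<lambda>s b. f x b # s) [] xs = rev (map (f x) xs)" for x xs
    by (induction xs rule: rev_induct) auto
  ultimately show ?thesis by simp
qed

lemma ptime_filter [ptime_intros]:
  assumes "ptime (\<lambda>p. P (fst p) (snd p))" "ptime l"
  shows "ptime (\<lambda>x. filter (P x) (l x))"
proof -
  have "ptime (\<lambda>x. foldl (\<lambda>s b. if P x b then b # s else s) [] (l x))"
  proof (rule ptime_foldl[where r = "[:1, 1:]"])
    show "ptime (\<lambda>p. if P (fst p) (snd (snd p)) then snd (snd p) # fst (snd p) else fst (snd p))"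
      using ptime_comp[OF assms(1) ptime_Pair[OF ptime_fst[OF ptime_id] ptime_snd[OF ptime_snd[OF ptime_id]]]]
      by (intro ptime_intros) simp
  qed (intro ptime_intros assms | simp)+
  from ptime_rev[OF this]
  have "ptime (\<lambda>x. rev (foldl (\<lambda>s b. if P x b then b # s else s) [] (l x)))" .
  moreover have "foldl (\<lambda>s b. if P x b then b # s else s) [] xs = rev (filter (P x) xs)" for x xs
    by (induction xs rule: rev_induct) auto
  ultimately show ?thesis by simp
qed

lemma ptime_list_ex [ptime_intros]:
  assumes "ptime (\<lambda>p. P (fst p) (snd p))" "ptime l"
  shows "ptime (\<lambda>x. list_ex (P x) (l x))"
proof -
  have "ptime (\<lambda>x. case filter (P x) (l x) of [] \<Rightarrow> False | _ # _ \<Rightarrow> True)"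
    by (intro ptime_intros assms)
  moreover have "(case filter (P x) xs of [] \<Rightarrow> False | _ # _ \<Rightarrow> True) = list_ex (P x) xs" for x xs
    by (induction xs) auto
  ultimately show ?thesis by simp
qed

lemma ptime_list_all [ptime_intros]:
  assumes "ptime (\<lambda>p. P (fst p) (snd p))" "ptime l"
  shows "ptime (\<lambda>x. list_all (P x) (l x))"
proof -
  have "ptime (\<lambda>x. \<not> list_ex (\<lambda>y. \<not> P x y) (l x))"
    by (intro ptime_intros assms)
  then show ?thesis by (simp add: list_ex_iff list_all_iff)
qed

lemma ptime_length [ptime_intros]:
  assumes "ptime l"
  shows "ptime (\<lambda>x. length (l x))"
proof -
  have "ptime (\<lambda>x. foldl (\<lambda>s b. Suc s) 0 (l x))"
    by (rule ptime_foldl[where r = "[:1:]"]) (intro ptime_intros assms | simp)+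
  moreover have "foldl (\<lambda>s b. Suc s) k xs = k + length xs" for k and xs :: "'b list"
    by (induction xs arbitrary: k) auto
  ultimately show ?thesis by simp
qed

lemma ptime_funpow:
  fixes f :: "'a :: encodable \<Rightarrow> 'b :: encodable \<Rightarrow> 'b"
  assumes step: "ptime (\<lambda>p. f (fst p) (snd p))" and "ptime s" "ptime n"
    and growth: "\<And>a s. size (enc (f a s)) \<le> size (enc s) + poly r (size (enc a))"
  shows "ptime (\<lambda>x. (f x ^^ n x) (s x))"
proof -
  have "ptime (\<lambda>x. foldl (\<lambda>s _. f x s) (s x) (replicate (n x) ()))"
  proof (rule ptime_foldl[where r = r])
    show "ptime (\<lambda>p. f (fst p) (fst (snd p)))"
      using ptime_comp[OF assms(1) ptime_Pair[OF ptime_fst[OF ptime_id] ptime_fst[OF ptime_snd[OF ptime_id]]]]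
      by simp
  qed (intro ptime_intros assms | simp add: growth)+
  moreover have "foldl (\<lambda>s _. g s) t (replicate k ()) = (g ^^ k) t" for g :: "'b \<Rightarrow> 'b" and t k
    by (induction k arbitrary: t) (auto simp: funpow_swap1)
  ultimately show ?thesis by simp
qed

lemma ptime_add [ptime_intros]:
  fixes m n :: "'a :: encodable \<Rightarrow> nat"
  assumes "ptime m" "ptime n"
  shows "ptime (\<lambda>x. m x + n x)"
proof -
  have "ptime (\<lambda>x. (Suc ^^ m x) (n x))"
    by (rule ptime_funpow[where r = "[:1:]"]) (intro ptime_intros assms | simp)+
  moreover have "(Suc ^^ k) l = k + l" for k l
    by (induction k) auto
  ultimately show ?thesis by simp
qed

lemma ptime_diff [ptime_intros]:
  fixes m n :: "'a :: encodable \<Rightarrow> nat"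
  assumes "ptime m" "ptime n"
  shows "ptime (\<lambda>x. m x - n x)"
proof -
  have "ptime (\<lambda>x. ((\<lambda>k. k - Suc 0) ^^ n x) (m x))"
    by (rule ptime_funpow[where r = "[:0:]"]) (intro ptime_intros assms | simp)+
  moreover have "((\<lambda>k. k - Suc 0) ^^ k) l = l - k" for k l
    by (induction k) auto
  ultimately show ?thesis by simp
qed

lemma ptime_mult [ptime_intros]:
  fixes m n :: "'a :: encodable \<Rightarrow> nat"
  assumes "ptime m" "ptime n"
  shows "ptime (\<lambda>x. m x * n x)"
proof -
  obtain p where p: "\<And>x. size (enc (n x)) \<le> poly p (size (enc x))"
    using assms(2) unfolding ptime_def by blast
  have "ptime (\<lambda>x. ((\<lambda>k. n x + k) ^^ m x) 0)"
  proof (rule ptime_funpow[where r = p])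
    show "ptime (\<lambda>q. n (fst q) + snd q)"
      by (intro ptime_intros ptime_comp[OF assms(2)])
    show "size (enc (n x + k)) \<le> size (enc k) + poly p (size (enc x))" for x and k :: nat
      using p[of x] by simp
  qed (intro ptime_intros assms)+
  moreover have "((\<lambda>k. l + k) ^^ k) 0 = k * l" for k l :: nat
    by (induction k) auto
  ultimately show ?thesis by simp
qed

lemma ptime_le [ptime_intros]:
  fixes m n :: "'a :: encodable \<Rightarrow> nat"
  assumes "ptime m" "ptime n"
  shows "ptime (\<lambda>x. m x \<le> n x)"
proof -
  have "ptime (\<lambda>x. case replicate (m x - n x) () of [] \<Rightarrow> True | _ # _ \<Rightarrow> False)"
    by (intro ptime_intros assms)
  moreover have "(case replicate (k - l) () of [] \<Rightarrow> True | _ # _ \<Rightarrow> False) \<longleftrightarrow> k \<le> l" for k l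
    by (cases "k - l") auto
  ultimately show ?thesis by simp
qed

lemma ptime_less [ptime_intros]:
  fixes m n :: "'a :: encodable \<Rightarrow> nat"
  assumes "ptime m" "ptime n"
  shows "ptime (\<lambda>x. m x < n x)"
  unfolding less_eq_Suc_le by (intro ptime_intros assms)

lemma ptime_eq_nat [ptime_intros]:
  fixes m n :: "'a :: encodable \<Rightarrow> nat"
  assumes "ptime m" "ptime n"
  shows "ptime (\<lambda>x. m x = n x)"
  unfolding eq_iff by (intro ptime_intros assms)

lemma ptime_min [ptime_intros]:
  fixes m n :: "'a :: encodable \<Rightarrow> nat"
  assumes "ptime m" "ptime n"
  shows "ptime (\<lambda>x. min (m x) (n x))"
  unfolding min_def by (intro ptime_intros assms)

lemma size_enc_tl: "size (enc (tl xs)) \<le> size (enc xs)"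
  by (cases xs) auto

lemma ptime_drop [ptime_intros]:
  assumes "ptime n" "ptime l"
  shows "ptime (\<lambda>x. drop (n x) (l x))"
proof -
  have "ptime (\<lambda>x. (tl ^^ n x) (l x))"
    by (rule ptime_funpow[where r = "[:0:]"]) (intro ptime_intros assms | simp add: size_enc_tl)+
  moreover have "(tl ^^ k) xs = drop k xs" for k and xs :: "'b list"
    by (induction k) (auto simp: drop_Suc tl_drop)
  ultimately show ?thesis by simp
qed

text \<open>The element added in a round is the counter, which is part of the accumulator. So the
  condition of \<open>ptime_foldl\<close> fails and the quadratic size is bounded directly.\<close>

lemma ptime_upt [ptime_intros]:
  assumes "ptime n"
  shows "ptime (\<lambda>x. [0..<n x])"
proof -
  let ?g = "\<lambda>s _ :: unit. (Suc (fst s), fst s # snd s)"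
  have g: "foldl ?g (0, []) (replicate k ()) = (k, rev [0..<k])" for k
  proof (induction k)
    case (Suc k)
    have "replicate (Suc k) () = replicate k () @ [()]"
      by (simp add: replicate_append_same)
    then show ?case by (simp add: Suc del: replicate_Suc)
  qed simp
  obtain p where p: "\<And>x. n x \<le> poly p (size (enc x))"
    using assms unfolding ptime_def by auto
  have "ptime (\<lambda>x. foldl ?g (0, []) (replicate (n x) ()))"
  proof (rule ptime_foldl_bounded[where r = "[:1:] + p + p * ([:1:] + p)"])
    fix x i assume "i \<le> length (replicate (n x) ())"
    then have i: "i \<le> n x" by simp
    have "size (enc (rev [0..<i])) \<le> length (rev [0..<i]) * Suc (n x)"
      by (rule size_enc_list_le) (use i in auto)
    also have "\<dots> \<le> n x * Suc (n x)"
      unfolding length_rev length_upt using i by (intro mult_le_mono1) simp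
    also have "\<dots> \<le> poly p (size (enc x)) * (1 + poly p (size (enc x)))"
      using p[of x] by (intro mult_le_mono) auto
    finally show "size (enc (foldl ?g (0, []) (take i (replicate (n x) ()))))
        \<le> poly ([:1:] + p + p * ([:1:] + p)) (size (enc x))"
      using i p[of x] by (simp add: g min_def)
  qed (intro ptime_intros assms)+
  then have "ptime (\<lambda>x. rev (snd (foldl ?g (0, []) (replicate (n x) ()))))"
    by (intro ptime_intros)
  then show ?thesis by (simp add: g)
qed

lemma ptime_Let [ptime_intros]:
  assumes "ptime f" "ptime (\<lambda>p. g (fst p) (snd p))"
  shows "ptime (\<lambda>x. let y = f x in g x y)"
  using ptime_comp[OF assms(2) ptime_Pair[OF ptime_id assms(1)]] by (simp add: Let_def)

text \<open>A total lookup, because polynomial time is shown for all trees of the right type. With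
  the default \<open>False\<close>, numbers that are not vertices have no neighbours and are not in
  the modulator.\<close>

definition entry :: "'a \<Rightarrow> 'a list \<Rightarrow> nat \<Rightarrow> 'a" where
  "entry d l i = (case drop i l of [] \<Rightarrow> d | x # _ \<Rightarrow> x)"

lemma entry_eq: "entry d l i = (if i < length l then l ! i else d)"
  unfolding entry_def by (auto simp: Cons_nth_drop_Suc[symmetric])

lemma ptime_entry [ptime_intros]:
  assumes "ptime d" "ptime l" "ptime i"
  shows "ptime (\<lambda>x. entry (d x) (l x) (i x))"
  unfolding entry_def by (intro ptime_intros assms)

section \<open>Binary numbers\<close>

fun increment :: "bool list \<Rightarrow> bool list" where
  "increment [] = [True]"
| "increment (False # bs) = True # bs"
| "increment (True # bs) = False # increment bs"

lemma size_enc_increment: "size (enc (increment bs)) \<le> size (enc bs) + 2"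
  by (induction bs rule: increment.induct) auto

lemma increment_binary_digits: "increment (binary_digits n) = binary_digits (Suc n)"
proof (induction n rule: binary_digits.induct)
  case (1 n)
  show ?case
  proof (cases "n = 0")
    case True
    then show ?thesis by (simp add: binary_digits.simps)
  next
    case False
    then show ?thesis
      using 1 by (subst (1 2) binary_digits.simps, cases "odd n") simp_all
  qed
qed

text \<open>Counting up from zero converts unary to binary; the number of increments is the size of
  the unary number.\<close>

lemma funpow_increment: "(increment ^^ n) [] = binary_digits n"
proof (induction n)
  case 0
  show ?case by (simp add: binary_digits.simps)
qed (simp add: increment_binary_digits)

lemma ptime_increment [ptime_intros]:
  assumes "ptime l"
  shows "ptime (\<lambda>x. increment (l x))"
proof -
  \<comment> \<open>The accumulator consists of the carry and the digits produced so far, in reverse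
    order.\<close>
  define add :: "bool \<times> bool list \<Rightarrow> bool \<Rightarrow> bool \<times> bool list"
    where "add s b = (fst s \<and> b, (if fst s then \<not> b else b) # snd s)" for s b
  have "size (enc (add s b)) \<le> size (enc s) + 3" for s b
    using size_enc_bool[of "fst s \<and> b"] size_enc_bool[of "if fst s then \<not> b else b"]
    by (cases s) (simp add: add_def)
  then have "ptime (\<lambda>x. foldl add (True, []) (l x))"
    by (intro ptime_foldl[where r = "[:3:]"]) (unfold add_def, (intro ptime_intros assms | simp)+)
  then have "ptime (\<lambda>x. let s = foldl add (True, []) (l x) in rev (snd s) @ (if fst s then [True] else []))"
    by (intro ptime_intros)
  moreover have "(let s = foldl add (c, acc) bs in rev (snd s) @ (if fst s then [True] else []))
      = rev acc @ (if c then increment bs else bs)" for c acc bs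
  proof (induction bs arbitrary: c acc)
    case (Cons b bs)
    then show ?case by (cases b; cases c) (simp_all add: add_def)
  qed simp
  ultimately show ?thesis by simp
qed

lemma ptime_binary_digits [ptime_intros]:
  assumes "ptime n"
  shows "ptime (\<lambda>x. binary_digits (n x))"
  unfolding funpow_increment[symmetric]
  by (rule ptime_funpow[where r = "[:2:]"])
    (intro ptime_intros assms | simp add: size_enc_increment[simplified])+

text \<open>Horner's scheme from the most significant digit, with every intermediate value capped.
  The full value in unary could be exponentially large.\<close>

definition capped_value :: "nat \<Rightarrow> bool list \<Rightarrow> nat" where
  "capped_value n bs = foldl (\<lambda>v b. min n (v + v + (if b then 1 else 0))) 0 (rev bs)"

text \<open>Capping before doubling does no harm: once a value has reached n, doubling and adding a
  digit leaves it at least n.\<close>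

lemma capped_value_binary_digits: "capped_value n (binary_digits k) = min n k"
proof (induction k rule: binary_digits.induct)
  case (1 k)
  show ?case
  proof (cases "k = 0")
    case True
    then show ?thesis by (simp add: binary_digits.simps capped_value_def)
  next
    case False
    then have "capped_value n (binary_digits k) = min n (2 * min n (k div 2) + (if odd k then 1 else 0))"
      using 1 by (subst binary_digits.simps) (simp add: capped_value_def mult_2)
    moreover have "k = 2 * (k div 2) + (if odd k then 1 else 0)"
      by simp
    ultimately show ?thesis
      by linarith
  qed
qed

lemma ptime_capped_value [ptime_intros]:
  assumes "ptime n" "ptime l"
  shows "ptime (\<lambda>x. capped_value (n x) (l x))"
proof -
  obtain p where p: "\<And>x. n x \<le> poly p (size (enc x))"
    using assms(1) unfolding ptime_def by auto
  show ?thesis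
    unfolding capped_value_def
  proof (rule ptime_foldl[where r = p])
    fix a v and b :: bool
    have "n a \<le> poly p (size (enc a) + size (enc b))"
      using p[of a] poly_nat_mono[of "size (enc a)" "size (enc a) + size (enc b)" p] by simp
    then show "size (enc (min (n a) (v + v + (if b then 1 else 0))))
        \<le> size (enc v) + poly p (size (enc a) + size (enc b))"
      by simp
  qed (intro ptime_intros assms ptime_comp[OF assms(1)])+
qed

section \<open>The algorithm\<close>

text \<open>The adjacency matrix of the graph and the characteristic vector of the modulator.\<close>

type_synonym input = "bool list list \<times> bool list"

definition adj :: "input \<Rightarrow> nat \<Rightarrow> nat \<Rightarrow> bool" where
  "adj a u v = entry False (entry [] (fst a) u) v"

definition in_mod :: "input \<Rightarrow> nat \<Rightarrow> bool" where
  "in_mod a u = entry False (snd a) u"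

definition vertex_list :: "input \<Rightarrow> nat list" where
  "vertex_list a = [0..<length (snd a)]"

text \<open>Distance one or two in \<open>G - X\<close>. Around the middle of a path these are the
  other four vertices, so components are handled without any graph search.\<close>

definition near :: "input \<Rightarrow> nat \<Rightarrow> nat \<Rightarrow> bool" where
  "near a c u \<longleftrightarrow> u \<noteq> c \<and> \<not> in_mod a u \<and>
    (adj a c u \<or> list_ex (\<lambda>w. \<not> in_mod a w \<and> adj a c w \<and> adj a w u) (vertex_list a))"

text \<open>Of the five vertices of a path, only the middle one has four others within distance two.\<close>

definition centre :: "input \<Rightarrow> nat \<Rightarrow> bool" where
  "centre a c \<longleftrightarrow> \<not> in_mod a c \<and> length (filter (near a c) (vertex_list a)) = 4"

definition linked :: "input \<Rightarrow> nat \<Rightarrow> nat \<Rightarrow> bool" where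
  "linked a c x \<longleftrightarrow> in_mod a x \<and> list_ex (\<lambda>u. near a c u \<and> adj a u x) (vertex_list a)"

text \<open>
  The state of the auction is the list of all purchases so far, the latest one first.
\<close>

type_synonym purchases = "(nat \<times> nat) list"

text \<open>The full history of sales determines prices and owners, and its length counts the rounds
  with a purchase.\<close>

definition price :: "purchases \<Rightarrow> nat \<Rightarrow> nat" where
  "price ps x = length (filter (\<lambda>e. snd e = x) ps)"

definition owns :: "purchases \<Rightarrow> nat \<Rightarrow> nat \<Rightarrow> bool" where
  "owns ps c x = (case filter (\<lambda>e. snd e = x) ps of [] \<Rightarrow> False | e # _ \<Rightarrow> fst e = c)"

text \<open>Choosing a cheapest vertex is what later keeps the price of an owned vertex close to
  those of the other linked vertices; the bound by the number of vertices is what ends the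
  auction.\<close>

definition affordable :: "input \<Rightarrow> purchases \<Rightarrow> nat \<Rightarrow> nat \<Rightarrow> bool" where
  "affordable a ps c x \<longleftrightarrow> linked a c x \<and> price ps x \<le> length (snd a) \<and>
     list_all (\<lambda>y. linked a c y \<longrightarrow> price ps x \<le> price ps y) (vertex_list a)"

definition bidder :: "input \<Rightarrow> purchases \<Rightarrow> nat \<Rightarrow> bool" where
  "bidder a ps c \<longleftrightarrow> centre a c \<and> \<not> list_ex (owns ps c) (vertex_list a) \<and>
     list_ex (affordable a ps c) (vertex_list a)"

definition auction_step :: "input \<Rightarrow> purchases \<Rightarrow> purchases" where
  "auction_step a ps =
    (case filter (bidder a ps) (vertex_list a) of [] \<Rightarrow> ps
     | c # _ \<Rightarrow> (case filter (affordable a ps c) (vertex_list a) of [] \<Rightarrow> ps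
         | x # _ \<Rightarrow> (c, x) # ps))"

text \<open>Prices never exceed n + 1, so there are at most n (n + 1) purchases and the extra round
  guarantees that the process has come to rest.\<close>

definition auction :: "input \<Rightarrow> purchases" where
  "auction a = (auction_step a ^^ Suc (length (snd a) * Suc (length (snd a)))) []"

text \<open>By the pigeonhole principle one of the n + 1 candidates is not a price, so the list is
  not empty and the default 0 is never returned.\<close>

definition gap :: "input \<Rightarrow> purchases \<Rightarrow> nat" where
  "gap a ps = (case filter (\<lambda>k. list_all (\<lambda>x. in_mod a x \<longrightarrow> price ps x \<noteq> k) (vertex_list a))
      [0..<Suc (length (snd a))] of [] \<Rightarrow> 0 | k # _ \<Rightarrow> k)"

definition cheap :: "input \<Rightarrow> purchases \<Rightarrow> nat \<Rightarrow> bool" where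
  "cheap a ps x \<longleftrightarrow> in_mod a x \<and> price ps x < gap a ps"

definition kept_centre :: "input \<Rightarrow> purchases \<Rightarrow> nat \<Rightarrow> bool" where
  "kept_centre a ps c \<longleftrightarrow> centre a c \<and> list_ex (\<lambda>x. cheap a ps x \<and> owns ps c x) (vertex_list a)"

definition kept :: "input \<Rightarrow> purchases \<Rightarrow> nat \<Rightarrow> bool" where
  "kept a ps u \<longleftrightarrow> cheap a ps u \<or> kept_centre a ps u \<or>
     list_ex (\<lambda>c. kept_centre a ps c \<and> near a c u) (vertex_list a)"

definition removed_paths :: "input \<Rightarrow> purchases \<Rightarrow> nat" where
  "removed_paths a ps = length (filter (\<lambda>c. centre a c \<and> \<not> kept_centre a ps c) (vertex_list a))"

text \<open>The budget is capped twice by a number of vertices. The first cap permits unary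
  arithmetic, the second keeps the size of the output bounded in terms of \<open>|X|\<close> alone.
  The rejecting output codes the empty graph with budget -1.\<close>

definition kernelize :: "bool list list \<times> bool list \<times> bool \<times> bool list
    \<Rightarrow> bool list list \<times> bool list \<times> bool \<times> bool list" where
  "kernelize i =
    (let a = (fst i, fst (snd i)); ps = auction a; vs = filter (kept a ps) (vertex_list a);
         d = removed_paths a ps; k = capped_value (length (snd a)) (snd (snd (snd i)))
     in if fst (snd (snd i)) \<or> k < d + d then ([], [], True, [True])
        else (map (\<lambda>u. map (adj a u) vs) vs, map (in_mod a) vs, False,
          binary_digits (min (length vs) (k - (d + d)))))"

section \<open>Polynomial running time of the algorithm\<close>

lemma ptime_adj [ptime_intros]:
  assumes "ptime a" "ptime u" "ptime v"
  shows "ptime (\<lambda>x. adj (a x) (u x) (v x))"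
  unfolding adj_def by (intro ptime_intros assms)

lemma ptime_in_mod [ptime_intros]:
  assumes "ptime a" "ptime u"
  shows "ptime (\<lambda>x. in_mod (a x) (u x))"
  unfolding in_mod_def by (intro ptime_intros assms)

lemma ptime_vertex_list [ptime_intros]:
  assumes "ptime a"
  shows "ptime (\<lambda>x. vertex_list (a x))"
  unfolding vertex_list_def by (intro ptime_intros assms)

lemma ptime_near [ptime_intros]:
  assumes "ptime a" "ptime c" "ptime u"
  shows "ptime (\<lambda>x. near (a x) (c x) (u x))"
  unfolding near_def by (intro ptime_intros assms ptime_comp[OF assms(1)] ptime_comp[OF assms(2)] ptime_comp[OF assms(3)])

lemma ptime_centre [ptime_intros]:
  assumes "ptime a" "ptime c"
  shows "ptime (\<lambda>x. centre (a x) (c x))"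
  unfolding centre_def by (intro ptime_intros assms ptime_comp[OF assms(1)] ptime_comp[OF assms(2)])

lemma ptime_linked [ptime_intros]:
  assumes "ptime a" "ptime c" "ptime y"
  shows "ptime (\<lambda>x. linked (a x) (c x) (y x))"
  unfolding linked_def
  by (intro ptime_intros assms ptime_comp[OF assms(1)] ptime_comp[OF assms(2)] ptime_comp[OF assms(3)])

lemma ptime_price [ptime_intros]:
  assumes "ptime ps" "ptime y"
  shows "ptime (\<lambda>x. price (ps x) (y x))"
  unfolding price_def by (intro ptime_intros assms ptime_comp[OF assms(2)])

lemma ptime_owns [ptime_intros]:
  assumes "ptime ps" "ptime c" "ptime y"
  shows "ptime (\<lambda>x. owns (ps x) (c x) (y x))"
  unfolding owns_def by (intro ptime_intros assms ptime_comp[OF assms(2)] ptime_comp[OF assms(3)])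

lemma ptime_affordable [ptime_intros]:
  assumes "ptime a" "ptime ps" "ptime c" "ptime y"
  shows "ptime (\<lambda>x. affordable (a x) (ps x) (c x) (y x))"
  unfolding affordable_def
  by (intro ptime_intros assms ptime_comp[OF assms(1)] ptime_comp[OF assms(2)]
      ptime_comp[OF assms(3)] ptime_comp[OF assms(4)])

lemma ptime_bidder [ptime_intros]:
  assumes "ptime a" "ptime ps" "ptime c"
  shows "ptime (\<lambda>x. bidder (a x) (ps x) (c x))"
  unfolding bidder_def
  by (intro ptime_intros assms ptime_comp[OF assms(1)] ptime_comp[OF assms(2)] ptime_comp[OF assms(3)])

lemma ptime_auction_step [ptime_intros]:
  assumes "ptime a" "ptime ps"
  shows "ptime (\<lambda>x. auction_step (a x) (ps x))"
  unfolding auction_step_def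
  by (intro ptime_intros assms ptime_comp[OF assms(1)] ptime_comp[OF assms(2)])

text \<open>A round adds at most one pair of unary numbers below n, so the history stays polynomial
  over all rounds.\<close>

lemma size_enc_auction_step:
  "size (enc (auction_step a ps)) \<le> size (enc ps) + poly [:2, 2:] (size (enc a))"
proof -
  have n: "length (snd a) \<le> size (enc a)"
    using length_le_size_enc[of "snd a"] by (cases a) simp
  show ?thesis
  proof (cases "auction_step a ps = ps")
    case False
    then obtain c x cs xs where
      "filter (bidder a ps) (vertex_list a) = c # cs" "filter (affordable a ps c) (vertex_list a) = x # xs"
      and eq: "auction_step a ps = (c, x) # ps"
      unfolding auction_step_def by (auto split: list.splits)
    then have "c \<in> set (filter (bidder a ps) (vertex_list a))"
      "x \<in> set (filter (affordable a ps c) (vertex_list a))"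
      by simp_all
    then show ?thesis
      using n by (simp add: eq vertex_list_def)
  qed simp
qed

lemma ptime_auction [ptime_intros]:
  assumes "ptime a"
  shows "ptime (\<lambda>x. auction (a x))"
proof (rule ptime_comp[OF _ assms])
  show "ptime auction"
    unfolding auction_def
    by (rule ptime_funpow[OF _ _ _ size_enc_auction_step]) (intro ptime_intros)+
qed

lemma ptime_gap [ptime_intros]:
  assumes "ptime a" "ptime ps"
  shows "ptime (\<lambda>x. gap (a x) (ps x))"
  unfolding gap_def by (intro ptime_intros assms ptime_comp[OF assms(1)] ptime_comp[OF assms(2)])

lemma ptime_cheap [ptime_intros]:
  assumes "ptime a" "ptime ps" "ptime y"
  shows "ptime (\<lambda>x. cheap (a x) (ps x) (y x))"
  unfolding cheap_def by (intro ptime_intros assms)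

lemma ptime_kept_centre [ptime_intros]:
  assumes "ptime a" "ptime ps" "ptime c"
  shows "ptime (\<lambda>x. kept_centre (a x) (ps x) (c x))"
  unfolding kept_centre_def
  by (intro ptime_intros assms ptime_comp[OF assms(1)] ptime_comp[OF assms(2)] ptime_comp[OF assms(3)])

lemma ptime_kept [ptime_intros]:
  assumes "ptime a" "ptime ps" "ptime u"
  shows "ptime (\<lambda>x. kept (a x) (ps x) (u x))"
  unfolding kept_def
  by (intro ptime_intros assms ptime_comp[OF assms(1)] ptime_comp[OF assms(2)] ptime_comp[OF assms(3)])

lemma ptime_removed_paths [ptime_intros]:
  assumes "ptime a" "ptime ps"
  shows "ptime (\<lambda>x. removed_paths (a x) (ps x))"
  unfolding removed_paths_def by (intro ptime_intros assms ptime_comp[OF assms(1)] ptime_comp[OF assms(2)])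

lemma ptime_kernelize: "ptime kernelize"
  unfolding kernelize_def by (intro ptime_intros)

section \<open>Outcome of the auction\<close>

lemma price_simps [simp]:
  "price [] x = 0"
  "price (e # ps) x = (if snd e = x then Suc (price ps x) else price ps x)"
  by (simp_all add: price_def)

lemma owns_simps [simp]:
  "owns [] c x \<longleftrightarrow> False"
  "owns (e # ps) c x \<longleftrightarrow> (if snd e = x then fst e = c else owns ps c x)"
  by (simp_all add: owns_def)

lemma owner_exists: "0 < price ps x \<Longrightarrow> \<exists>c. owns ps c x"
  by (induction ps) (auto split: if_splits)

lemma owner_unique: "owns ps c x \<Longrightarrow> owns ps c' x \<Longrightarrow> c = c'"
  by (induction ps) (auto split: if_splits)

lemma in_mod_less: "in_mod a x \<Longrightarrow> x < length (snd a)"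
  by (auto simp: in_mod_def entry_eq split: if_splits)

lemma linked_in_mod: "linked a c x \<Longrightarrow> in_mod a x"
  by (simp add: linked_def)

lemma set_vertex_list [simp]: "set (vertex_list a) = {..<length (snd a)}"
  by (auto simp: vertex_list_def)

text \<open>The last condition holds at a purchase because the buyer takes a cheapest linked vertex,
  whose price then rises by one. As long as that component owns the vertex, its price is fixed while
  other prices can only rise.\<close>

definition auction_inv :: "input \<Rightarrow> purchases \<Rightarrow> bool" where
  "auction_inv a ps \<longleftrightarrow>
    (\<forall>(c, x)\<in>set ps. c < length (snd a) \<and> centre a c \<and> linked a c x) \<and>
    (\<forall>x. price ps x \<le> Suc (length (snd a))) \<and>
    (\<forall>c x y. owns ps c x \<longrightarrow> owns ps c y \<longrightarrow> x = y) \<and>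
    (\<forall>c x y. owns ps c x \<longrightarrow> linked a c y \<longrightarrow> price ps x \<le> Suc (price ps y))"

lemma owns_member: "owns ps c x \<Longrightarrow> (c, x) \<in> set ps"
  by (induction ps) (auto split: if_splits)

lemma auction_inv_owns:
  assumes "auction_inv a ps" "owns ps c x"
  shows "c < length (snd a)" "centre a c" "linked a c x" "x < length (snd a)" "in_mod a x"
  using assms owns_member[of ps c x] linked_in_mod[of a c x] in_mod_less[of a x]
  by (auto simp: auction_inv_def)

lemma auction_step_cases:
  obtains "auction_step a ps = ps" "\<And>c. c < length (snd a) \<Longrightarrow> \<not> bidder a ps c"
  | c x where "auction_step a ps = (c, x) # ps" "c < length (snd a)" "bidder a ps c" "affordable a ps c x"
proof (cases "filter (bidder a ps) (vertex_list a)")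
  case Nil
  then show ?thesis
    using that(1) by (auto simp: auction_step_def filter_empty_conv)
next
  case (Cons c cs)
  then have "c \<in> set (filter (bidder a ps) (vertex_list a))"
    by simp
  then have c: "c < length (snd a)" "bidder a ps c"
    by auto
  obtain x xs where xs: "filter (affordable a ps c) (vertex_list a) = x # xs"
    using c(2) by (cases "filter (affordable a ps c) (vertex_list a)")
      (auto simp: bidder_def list_ex_iff filter_empty_conv)
  then have "x \<in> set (filter (affordable a ps c) (vertex_list a))"
    by simp
  then have "affordable a ps c x"
    by simp
  then show ?thesis
    using that(2)[of c x] c by (simp add: auction_step_def Cons xs)
qed

lemma auction_inv_step:
  assumes "auction_inv a ps"
  shows "auction_inv a (auction_step a ps)"
proof (cases rule: auction_step_cases[of a ps])
  case 1
  with assms show ?thesis by simp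
next
  case (2 c x)
  have c: "centre a c" "\<not> owns ps c y" for y
    using 2(3) auction_inv_owns(4)[OF assms, of c y] by (auto simp: bidder_def list_ex_iff)
  have x: "linked a c x" "price ps x \<le> length (snd a)"
    using 2(4) by (simp_all add: affordable_def)
  have le: "price ps x \<le> price ps y" if "linked a c y" for y
    using 2(4) that in_mod_less[OF linked_in_mod[OF that]] by (simp add: affordable_def list_all_iff)
  show ?thesis
    unfolding 2(1) auction_inv_def
  proof (intro conjI allI impI)
    fix c' x' y
    assume "owns ((c, x) # ps) c' x'" "owns ((c, x) # ps) c' y"
    then show "x' = y"
      using assms c(2) by (auto simp: auction_inv_def split: if_splits)
  next
    fix c' x' y
    assume *: "owns ((c, x) # ps) c' x'" "linked a c' y"
    have y: "price ps y \<le> price ((c, x) # ps) y"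
      by simp
    show "price ((c, x) # ps) x' \<le> Suc (price ((c, x) # ps) y)"
    \<comment> \<open>If \<open>x' = x\<close>, the owner is the buyer \<open>c\<close> and the
      minimality of its choice applies. Otherwise the price of \<open>x'\<close> is unchanged and
      the old inequality survives.\<close>
    proof (cases "x' = x")
      case True
      with * le[of y] y show ?thesis by simp
    next
      case False
      with * have "owns ps c' x'" by simp
      with * assms have "price ps x' \<le> Suc (price ps y)"
        by (simp add: auction_inv_def)
      with False y show ?thesis by simp
    qed
  qed (use assms 2(2) c(1) x in \<open>auto simp: auction_inv_def\<close>)
qed

lemma length_eq_sum_price:
  assumes "\<And>e. e \<in> set ps \<Longrightarrow> snd e < n"
  shows "length ps = (\<Sum>x<n. price ps x)"
  using assms
proof (induction ps)
  case (Cons e ps)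
  have "price (e # ps) x = (if x = snd e then 1 else 0) + price ps x" for x
    by auto
  then have "(\<Sum>x<n. price (e # ps) x) = (\<Sum>x<n. if x = snd e then 1 else 0) + (\<Sum>x<n. price ps x)"
    by (simp only: sum.distrib)
  also have "(\<Sum>x<n. if x = snd e then 1 else 0) = (1 :: nat)"
    using Cons.prems[of e] by simp
  finally show ?case
    using Cons by simp
qed simp

text \<open>Every purchase raises exactly one price by one, so the number of purchases is the sum of
  all prices.\<close>

lemma auction_inv_length:
  assumes "auction_inv a ps"
  shows "length ps \<le> length (snd a) * Suc (length (snd a))"
proof -
  have "snd e < length (snd a)" if "e \<in> set ps" for e
  proof -
    have "linked a (fst e) (snd e)"
      using assms that by (auto simp: auction_inv_def)
    then show ?thesis
      by (intro in_mod_less linked_in_mod)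
  qed
  then have "length ps = (\<Sum>x<length (snd a). price ps x)"
    by (rule length_eq_sum_price)
  also have "\<dots> \<le> (\<Sum>x<length (snd a). Suc (length (snd a)))"
    using assms by (intro sum_mono) (simp add: auction_inv_def)
  finally show ?thesis by simp
qed

lemma auction_inv_funpow: "auction_inv a ((auction_step a ^^ k) [])"
  by (induction k) (simp_all add: auction_inv_step, simp add: auction_inv_def)

lemma auction_inv_auction: "auction_inv a (auction a)"
  unfolding auction_def by (rule auction_inv_funpow)

lemma auction_no_bidder:
  assumes "c < length (snd a)"
  shows "\<not> bidder a (auction a) c"
proof -
  \<comment> \<open>Until the first idle round every round is a purchase, and after an idle round
    the state stays the same forever. The number of rounds rules out the first alternative.\<close>
  have "auction_step a ((auction_step a ^^ k) []) = (auction_step a ^^ k) [] \<or>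
      length ((auction_step a ^^ k) []) = k" for k
  proof (induction k)
    case (Suc k)
    then show ?case
      by (cases rule: auction_step_cases[of a "(auction_step a ^^ k) []"]) auto
  qed simp
  moreover have "length (auction a) \<noteq> Suc (length (snd a) * Suc (length (snd a)))"
    using auction_inv_length[OF auction_inv_auction[of a]] by linarith
  ultimately have "auction_step a (auction a) = auction a"
    unfolding auction_def by blast
  then show ?thesis
    using assms by (cases rule: auction_step_cases[of a "auction a"]) auto
qed

text \<open>Otherwise a cheapest linked vertex would cost at most n, and the component would still
  be a bidder.\<close>

lemma auction_unmatched:
  assumes "c < length (snd a)" "centre a c" "\<And>x. \<not> owns (auction a) c x" "linked a c y"
  shows "length (snd a) < price (auction a) y"
proof (rule ccontr)
  assume neg: "\<not> ?thesis"
  define x where "x = arg_min (price (auction a)) (linked a c)"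
  have x: "linked a c x" "\<And>z. linked a c z \<Longrightarrow> price (auction a) x \<le> price (auction a) z"
    unfolding x_def using arg_min_nat_lemma[of "linked a c" y "price (auction a)"] assms(4) by auto
  then have "affordable a (auction a) c x"
    using neg x(2)[OF assms(4)] by (auto simp: affordable_def list_all_iff)
  then have "bidder a (auction a) c"
    using assms(2,3) in_mod_less[OF linked_in_mod[OF x(1)]] by (auto simp: bidder_def list_ex_iff)
  then show False
    using auction_no_bidder[OF assms(1)] by simp
qed

section \<open>Splitting the modulator at a missing price\<close>

lemma gap_properties:
  shows "gap a ps \<le> length (snd a)" and "in_mod a x \<Longrightarrow> price ps x \<noteq> gap a ps"
proof -
  let ?n = "length (snd a)"
  let ?P = "\<lambda>k. list_all (\<lambda>x. in_mod a x \<longrightarrow> price ps x \<noteq> k) (vertex_list a)"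
  have "card (price ps ` {..<?n}) < card {..?n}"
    using card_image_le[of "{..<?n}" "price ps"] by simp
  then obtain k where "k \<le> ?n" "k \<notin> price ps ` {..<?n}"
    using card_mono[of "price ps ` {..<?n}" "{..?n}"] by fastforce
  then have "?P k" "k \<in> set [0..<Suc ?n]"
    by (auto simp: list_all_iff simp del: upt_Suc)
  then have "k \<in> set (filter ?P [0..<Suc ?n])"
    unfolding set_filter by blast
  then obtain j js where j: "filter ?P [0..<Suc ?n] = j # js"
    by (cases "filter ?P [0..<Suc ?n]") (simp_all del: upt_Suc set_filter)
  then have gap: "gap a ps = j"
    by (simp add: gap_def)
  have "j \<in> set (filter ?P [0..<Suc ?n])"
    unfolding j by simp
  then have "j \<in> set [0..<Suc ?n]" "?P j"
    unfolding set_filter by blast+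
  then show "gap a ps \<le> ?n" "in_mod a x \<Longrightarrow> price ps x \<noteq> gap a ps"
    unfolding gap using in_mod_less[of a x] by (auto simp: list_all_iff simp del: upt_Suc)
qed

text \<open>
  A buyer's price exceeds the price of any other modulator vertex linked to it by at most one, so
  no removed component is linked to a vertex priced below the gap.
\<close>

lemma removed_not_linked_cheap:
  assumes "c < length (snd a)" "centre a c" "\<not> kept_centre a (auction a) c" "linked a c x"
  shows "\<not> cheap a (auction a) x"
proof -
  let ?ps = "auction a"
  have x: "in_mod a x" using assms(4) by (rule linked_in_mod)
  have "gap a ?ps \<le> price ?ps x"
  proof (cases "\<exists>y. owns ?ps c y")
    case True
    then obtain y where y: "owns ?ps c y" by blast
    note y' = auction_inv_owns[OF auction_inv_auction y]
    have "\<not> cheap a ?ps y"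
      using assms(2,3) y y'(4) by (auto simp: kept_centre_def list_ex_iff)
    then have "gap a ?ps < price ?ps y"
      using y'(5) gap_properties(2)[OF y'(5), of ?ps] by (simp add: cheap_def)
    moreover have "price ?ps y \<le> Suc (price ?ps x)"
      using auction_inv_auction[of a] y assms(4) by (auto simp: auction_inv_def)
    ultimately show ?thesis by simp
  next
    case False
    then show ?thesis
      using auction_unmatched[OF assms(1,2) _ assms(4)] gap_properties(1)[of a ?ps] by fastforce
  qed
  then show ?thesis
    by (simp add: cheap_def)
qed

text \<open>A vertex above the gap has a positive price and hence an owner, which serves as its
  partner. A component owns at most one vertex; this makes the map injective, and it shows that the
  owner holds no cheap vertex and is therefore not kept.\<close>

lemma removed_matching:
  obtains m where "inj_on m {x. in_mod a x \<and> \<not> cheap a (auction a) x}"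
    and "\<And>x. in_mod a x \<Longrightarrow> \<not> cheap a (auction a) x \<Longrightarrow>
      m x < length (snd a) \<and> centre a (m x) \<and> \<not> kept_centre a (auction a) (m x) \<and> linked a (m x) x"
proof -
  let ?ps = "auction a"
  define m where "m x = (SOME c. owns ?ps c x)" for x
  have own: "owns ?ps (m x) x" if "in_mod a x" "\<not> cheap a ?ps x" for x
  proof -
    have "0 < price ?ps x"
      using that gap_properties(2)[of a x ?ps] by (auto simp: cheap_def)
    then show ?thesis
      unfolding m_def by (rule someI_ex[OF owner_exists])
  qed
  have single: "x = y" if "owns ?ps c x" "owns ?ps c y" for c x y
    using auction_inv_auction[of a] that by (auto simp: auction_inv_def)
  show ?thesis
  proof
    show "inj_on m {x. in_mod a x \<and> \<not> cheap a ?ps x}"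
    proof (rule inj_onI)
      fix x y
      assume x: "x \<in> {x. in_mod a x \<and> \<not> cheap a ?ps x}"
        and y: "y \<in> {x. in_mod a x \<and> \<not> cheap a ?ps x}" and eq: "m x = m y"
      have "owns ?ps (m x) x" "owns ?ps (m x) y"
        using own[of x] own[of y] x y eq by simp_all
      then show "x = y" by (rule single)
    qed
    show "m x < length (snd a) \<and> centre a (m x) \<and> \<not> kept_centre a ?ps (m x) \<and> linked a (m x) x"
      if "in_mod a x" "\<not> cheap a ?ps x" for x
      using auction_inv_owns[OF auction_inv_auction own[OF that]] single[OF own[OF that]] that
      by (auto simp: kept_centre_def list_ex_iff)
  qed
qed

lemma card_kept_centres:
  "card {c. kept_centre a (auction a) c} \<le> card {x. cheap a (auction a) x}"
proof -
  let ?ps = "auction a"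
  define f where "f c = (SOME x. cheap a ?ps x \<and> owns ?ps c x)" for c
  have f: "cheap a ?ps (f c) \<and> owns ?ps c (f c)" if "kept_centre a ?ps c" for c
    unfolding f_def by (rule someI_ex) (use that in \<open>auto simp: kept_centre_def list_ex_iff\<close>)
  show ?thesis
  proof (rule card_inj_on_le)
    show "inj_on f {c. kept_centre a ?ps c}"
    proof (rule inj_onI)
      fix c d
      assume "c \<in> {c. kept_centre a ?ps c}" "d \<in> {c. kept_centre a ?ps c}" "f c = f d"
      then show "c = d"
        using f[of c] f[of d] owner_unique[of ?ps c "f c" d] by simp
    qed
    show "finite {x. cheap a ?ps x}"
      by (rule finite_subset[of _ "{..<length (snd a)}"]) (use in_mod_less[of a] in \<open>auto simp: cheap_def\<close>)
  qed (use f in auto)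
qed

section \<open>Edge dominating sets\<close>

definition has_eds :: "'a graph \<Rightarrow> nat \<Rightarrow> bool" where
  "has_eds G k \<longleftrightarrow> (\<exists>F. edge_dominating_set G F \<and> card F \<le> k)"

lemma simple_graph_edgeE:
  assumes "simple_graph G" "e \<in> edges G"
  obtains u v where "u \<in> verts G" "v \<in> verts G" "u \<noteq> v" "e = {u, v}"
  using assms unfolding simple_graph_def by blast

lemma simple_graph_edge_verts:
  assumes "simple_graph G" "{u, v} \<in> edges G"
  shows "u \<in> verts G" "v \<in> verts G" "u \<noteq> v"
  using simple_graph_edgeE[OF assms] by (metis doubleton_eq_iff insert_absorb2 singleton_insert_inj_eq')+

lemma simple_graph_edge_other:
  assumes "simple_graph G" "e \<in> edges G" "u \<in> e"
  obtains v where "e = {u, v}" "v \<in> verts G" "v \<noteq> u"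
  using assms(3) simple_graph_edgeE[OF assms(1,2)] that by (metis insert_commute insertE singletonD)

lemma edge_subset_verts: "simple_graph G \<Longrightarrow> e \<in> edges G \<Longrightarrow> e \<subseteq> verts G"
  by (auto elim: simple_graph_edgeE)

lemma finite_edges: "simple_graph G \<Longrightarrow> finite (edges G)"
  by (rule finite_subset[of _ "Pow (verts G)"]) (auto dest: edge_subset_verts simp: simple_graph_def)

lemma finite_eds: "simple_graph G \<Longrightarrow> edge_dominating_set G F \<Longrightarrow> finite F"
  unfolding edge_dominating_set_def by (meson finite_edges finite_subset)

lemma verts_delete [simp]: "verts (delete_vertices G S) = verts G - S"
  by (auto simp: delete_vertices_def induced_subgraph_def)

lemma edges_delete: "edges (delete_vertices G S) = {e \<in> edges G. e \<subseteq> verts G - S}"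
  by (auto simp: delete_vertices_def induced_subgraph_def)

lemma simple_graph_delete: "simple_graph G \<Longrightarrow> simple_graph (delete_vertices G S)"
  unfolding simple_graph_def edges_delete by fastforce

text \<open>One incident edge for each non-isolated vertex dominates every edge. This crude bound
  justifies capping the budget.\<close>

lemma has_eds_card_verts:
  assumes "simple_graph G"
  shows "has_eds G (card (verts G))"
proof -
  define f where "f v = (SOME e. e \<in> edges G \<and> v \<in> e)" for v
  have f: "f v \<in> edges G \<and> v \<in> f v" if "e \<in> edges G" "v \<in> e" for e v
    unfolding f_def by (rule someI_ex) (use that in blast)
  let ?F = "f ` (verts G \<inter> \<Union>(edges G))"
  have "edge_dominating_set G ?F"
    unfolding edge_dominating_set_def
  proof (intro conjI ballI)
    show "?F \<subseteq> edges G" using f by auto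
    fix e assume e: "e \<in> edges G"
    then obtain u v where "u \<in> verts G" "e = {u, v}"
      using simple_graph_edgeE[OF assms] by metis
    then show "\<exists>g\<in>?F. e \<inter> g \<noteq> {}"
      using f[OF e, of u] e by (intro bexI[of _ "f u"]) auto
  qed
  moreover have "card ?F \<le> card (verts G)"
    using assms by (intro order.trans[OF card_image_le card_mono]) (auto simp: simple_graph_def)
  ultimately show ?thesis
    unfolding has_eds_def by blast
qed

lemma has_eds_mono: "has_eds G k \<Longrightarrow> k \<le> l \<Longrightarrow> has_eds G l"
  unfolding has_eds_def by (meson le_trans)

lemma has_eds_min:
  "simple_graph G \<Longrightarrow> has_eds G (min (card (verts G)) k) \<longleftrightarrow> has_eds G k"
  using has_eds_card_verts[of G] has_eds_mono[of G] by (metis min.cobounded2 min_def)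

lemma has_eds_image:
  assumes "simple_graph G" and inj: "inj_on f (verts G)" and edges: "edges H = (`) f ` edges G"
  shows "has_eds H k \<longleftrightarrow> has_eds G k"
proof -
  have inj_edges: "inj_on ((`) f) (edges G)"
    using edge_subset_verts[OF assms(1)] inj by (metis (mono_tags) inj_onI inj_on_image_eq_iff)
  have meet: "f ` e \<inter> f ` e' \<noteq> {} \<longleftrightarrow> e \<inter> e' \<noteq> {}" if "e \<in> edges G" "e' \<in> edges G" for e e'
    using edge_subset_verts[OF assms(1)] that inj by (simp flip: inj_on_image_Int)
  have dominating: "edge_dominating_set H ((`) f ` F) \<longleftrightarrow> edge_dominating_set G F" if "F \<subseteq> edges G" for F
  proof -
    have "edge_dominating_set H ((`) f ` F) \<longleftrightarrow> (\<forall>e\<in>edges G. \<exists>g\<in>F. f ` e \<inter> f ` g \<noteq> {})"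
      using that by (simp add: edge_dominating_set_def edges image_mono)
    also have "\<dots> \<longleftrightarrow> (\<forall>e\<in>edges G. \<exists>g\<in>F. e \<inter> g \<noteq> {})"
      using meet subsetD[OF that] by (intro ball_cong bex_cong refl) blast
    finally show ?thesis
      using that by (simp add: edge_dominating_set_def)
  qed
  have card: "card ((`) f ` F) = card F" if "F \<subseteq> edges G" for F
    using card_image inj_on_subset[OF inj_edges that] by blast
  show ?thesis
  proof
    assume "has_eds H k"
    then obtain F where F: "edge_dominating_set H F" "card F \<le> k"
      unfolding has_eds_def by blast
    then obtain F' where "F' \<subseteq> edges G" "F = (`) f ` F'"
      unfolding edge_dominating_set_def edges by (meson subset_imageE)
    then show "has_eds G k"
      using F dominating card unfolding has_eds_def by metis
  next
    assume "has_eds G k"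
    then obtain F where F: "edge_dominating_set G F" "card F \<le> k"
      unfolding has_eds_def by blast
    then have "F \<subseteq> edges G"
      by (simp add: edge_dominating_set_def)
    then show "has_eds H k"
      using F dominating card unfolding has_eds_def by metis
  qed
qed

text \<open>An edge leaving \<open>S\<close> is replaced by any remaining edge at its endpoint outside \<open>S\<close>.\<close>

lemma eds_delete_vertices:
  assumes G: "simple_graph G" and F: "edge_dominating_set G F"
  shows "has_eds (delete_vertices G S) (card F - card {f \<in> F. f \<subseteq> S})"
proof -
  let ?H = "delete_vertices G S"
  \<comment> \<open>These are the edges of \<open>F\<close> that have a replacement: an edge
    disjoint from \<open>S\<close> is its own, and an edge with one end outside \<open>S\<close>
    needs some remaining edge at that end. Edges inside \<open>S\<close> are dropped, which is the
    saving.\<close>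
  let ?D = "{f \<in> F. \<not> f \<subseteq> S \<and> (\<exists>e\<in>edges ?H. f - S \<subseteq> e)}"
  define r where "r f = (SOME e. e \<in> edges ?H \<and> f - S \<subseteq> e)" for f
  have r: "r f \<in> edges ?H \<and> f - S \<subseteq> r f" if "f \<in> ?D" for f
    unfolding r_def by (rule someI_ex) (use that in blast)
  have F_edges: "F \<subseteq> edges G"
    using F by (simp add: edge_dominating_set_def)
  have "edge_dominating_set ?H (r ` ?D)"
    unfolding edge_dominating_set_def
  proof (intro conjI ballI)
    show "r ` ?D \<subseteq> edges ?H" using r by auto
    fix e assume e: "e \<in> edges ?H"
    then have e': "e \<in> edges G" "e \<subseteq> verts G - S" by (auto simp: edges_delete)
    then obtain f v where f: "f \<in> F" "v \<in> e" "v \<in> f"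
      using F unfolding edge_dominating_set_def by blast
    have fG: "f \<in> edges G" using f F_edges by auto
    obtain w where w: "f = {v, w}" "w \<in> verts G"
      using simple_graph_edge_other[OF G fG f(3)] by metis
    have v: "v \<notin> S" "v \<in> verts G" using e' f by auto
    have "\<exists>e\<in>edges ?H. f - S \<subseteq> e"
    proof (cases "w \<in> S")
      case True
      then show ?thesis using e f w by auto
    next
      case False
      then have "f \<in> edges ?H" using fG w v by (auto simp: edges_delete)
      then show ?thesis by auto
    qed
    then have "f \<in> ?D" using f v by auto
    then show "\<exists>g\<in>r ` ?D. e \<inter> g \<noteq> {}"
      using r[of f] f v by blast
  qed
  moreover have "card (r ` ?D) \<le> card F - card {f \<in> F. f \<subseteq> S}"
  proof -
    have fin: "finite F" using finite_eds[OF G F] .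
    have "card (r ` ?D) \<le> card ?D"
      using fin by (intro card_image_le) simp
    also have "\<dots> \<le> card (F - {f \<in> F. f \<subseteq> S})"
      using fin by (intro card_mono) auto
    also have "\<dots> = card F - card {f \<in> F. f \<subseteq> S}"
      using fin by (intro card_Diff_subset) auto
    finally show ?thesis .
  qed
  ultimately show ?thesis
    unfolding has_eds_def by blast
qed

section \<open>Components that are paths on five vertices\<close>

text \<open>The equivalence ranges over all \<open>w\<close> and so forbids edges leaving the image:
  \<open>p\<close> enumerates an entire component in path order, not just a path.\<close>

definition path_component :: "'a graph \<Rightarrow> (nat \<Rightarrow> 'a) \<Rightarrow> bool" where
  "path_component H p \<longleftrightarrow> inj_on p {..<5} \<and> p ` {..<5} \<subseteq> verts H \<and>
     (\<forall>i<5. \<forall>w. {p i, w} \<in> edges H \<longleftrightarrow> (\<exists>j<5. w = p j \<and> (j = Suc i \<or> i = Suc j)))"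

lemma path_component_edge:
  assumes "path_component H p" "i < 5"
  shows "{p i, w} \<in> edges H \<longleftrightarrow> (\<exists>j<5. w = p j \<and> (j = Suc i \<or> i = Suc j))"
  using assms unfolding path_component_def by blast

lemma sym_adjacency_rtrancl: "(u, v) \<in> (adjacency H)\<^sup>* \<Longrightarrow> (v, u) \<in> (adjacency H)\<^sup>*"
proof -
  have "sym (adjacency H)"
    by (auto simp: sym_def adjacency_def insert_commute)
  then show "(u, v) \<in> (adjacency H)\<^sup>* \<Longrightarrow> (v, u) \<in> (adjacency H)\<^sup>*"
    by (meson sym_rtrancl symD)
qed

text \<open>The image is closed under adjacency. Conversely, \<open>p i\<close> and every
  \<open>p j\<close> are connected through \<open>p 0\<close>, using symmetry for the way
  back.\<close>

lemma path_component_reachable: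
  assumes p: "path_component H p" and "i < 5"
  shows "(adjacency H)\<^sup>* `` {p i} = p ` {..<5}"
proof
  have "w \<in> p ` {..<5}" if "(p i, w) \<in> (adjacency H)\<^sup>*" for w
    using that
  proof (induction rule: rtrancl_induct)
    case base
    then show ?case using assms(2) by simp
  next
    case (step v w)
    then obtain j where "j < 5" "v = p j" by auto
    with step(2) show ?case
      using path_component_edge[OF p] by (auto simp: adjacency_def)
  qed
  then show "(adjacency H)\<^sup>* `` {p i} \<subseteq> p ` {..<5}"
    by blast
  have from_0: "(p 0, p j) \<in> (adjacency H)\<^sup>*" if "j < 5" for j
    using that
  proof (induction j)
    case (Suc j)
    have "{p j, p (Suc j)} \<in> edges H"
      using path_component_edge[OF p Suc_lessD[OF Suc.prems], of "p (Suc j)"] Suc.prems by blast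
    then have "(p j, p (Suc j)) \<in> adjacency H"
      by (simp add: adjacency_def)
    with Suc show ?case by (auto intro: rtrancl_into_rtrancl)
  qed simp
  then show "p ` {..<5} \<subseteq> (adjacency H)\<^sup>* `` {p i}"
    using rtrancl_trans[OF sym_adjacency_rtrancl[OF from_0[OF assms(2)]] from_0] by auto
qed

lemma path_graph_edge: "{i, j} \<in> edges (path_graph n) \<longleftrightarrow> i < n \<and> j < n \<and> (j = Suc i \<or> i = Suc j)"
  by (auto simp: path_graph_def doubleton_eq_iff)

text \<open>Replaces isomorphisms of connected components by explicit enumerations, obtained by
  inverting the isomorphism.\<close>

lemma P5_component_graph_iff:
  assumes H: "simple_graph H"
  shows "P5_component_graph H \<longleftrightarrow> (\<forall>u\<in>verts H. \<exists>p. path_component H p \<and> u \<in> p ` {..<5})"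
proof (intro iffI ballI)
  fix u assume "P5_component_graph H" and u: "u \<in> verts H"
  define R where "R = (adjacency H)\<^sup>* `` {u}"
  define C where "C = induced_subgraph H R"
  have "C \<in> connected_components H"
    unfolding C_def R_def connected_components_def using u by blast
  then have "graph_isomorphic C (path_graph 5)"
    using \<open>P5_component_graph H\<close> unfolding P5_component_graph_def by blast
  then obtain f where bij: "bij_betw f (verts C) {..<5}"
    and edge: "\<And>v w. v \<in> verts C \<Longrightarrow> w \<in> verts C \<Longrightarrow>
      {v, w} \<in> edges C \<longleftrightarrow> {f v, f w} \<in> edges (path_graph 5)"
    unfolding graph_isomorphic_def by (auto simp: path_graph_def)
  define p where "p = inv_into (verts C) f"
  have bij_p: "bij_betw p {..<5} (verts C)"
    unfolding p_def using bij by (rule bij_betw_inv_into)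
  have f_p: "f (p i) = i" if "i < 5" for i
    unfolding p_def using bij_betw_inv_into_right[OF bij] that by simp
  have p_f: "p (f w) = w" "f w < 5" if "w \<in> verts C" for w
    unfolding p_def using bij_betw_inv_into_left[OF bij that] bij_betwE[OF bij] that by auto
  have verts_C: "verts C = verts H \<inter> R" and edges_C: "edges C = {e \<in> edges H. e \<subseteq> R}"
    by (simp_all add: C_def induced_subgraph_def)
  have p_C: "p i \<in> verts C" if "i < 5" for i
    using bij_betwE[OF bij_p] that by simp
  have "path_component H p"
    unfolding path_component_def
  proof (intro conjI allI impI)
    show "inj_on p {..<5}" using bij_p by (rule bij_betw_imp_inj_on)
    show "p ` {..<5} \<subseteq> verts H" using p_C verts_C by auto
    fix i w assume i: "i < (5 :: nat)"
    show "{p i, w} \<in> edges H \<longleftrightarrow> (\<exists>j<5. w = p j \<and> (j = Suc i \<or> i = Suc j))"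
    proof
      assume e: "{p i, w} \<in> edges H"
      have "p i \<in> R" using p_C[OF i] verts_C by simp
      moreover have "(p i, w) \<in> adjacency H" using e by (simp add: adjacency_def)
      ultimately have "w \<in> R" unfolding R_def by (auto intro: rtrancl_into_rtrancl)
      then have w: "w \<in> verts C" "{p i, w} \<in> edges C"
        using simple_graph_edge_verts[OF H e] e \<open>p i \<in> R\<close> verts_C edges_C by auto
      then have "{i, f w} \<in> edges (path_graph 5)"
        using edge[OF p_C[OF i] w(1)] f_p[OF i] by simp
      then show "\<exists>j<5. w = p j \<and> (j = Suc i \<or> i = Suc j)"
        using p_f[OF w(1)] path_graph_edge by metis
    next
      assume "\<exists>j<5. w = p j \<and> (j = Suc i \<or> i = Suc j)"
      then obtain j where j: "j < 5" "w = p j" "j = Suc i \<or> i = Suc j" by blast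
      then have "{i, j} \<in> edges (path_graph 5)"
        using i path_graph_edge by blast
      then have "{p i, p j} \<in> edges C"
        using edge[OF p_C[OF i] p_C[OF j(1)]] f_p i j(1) by simp
      then show "{p i, w} \<in> edges H" using edges_C j by simp
    qed
  qed
  moreover have "u \<in> verts C"
    using u by (simp add: verts_C R_def)
  then have "u \<in> p ` {..<5}"
    using bij_betw_imp_surj_on[OF bij_p] by simp
  ultimately show "\<exists>p. path_component H p \<and> u \<in> p ` {..<5}" by blast
next
  assume cover: "\<forall>u\<in>verts H. \<exists>p. path_component H p \<and> u \<in> p ` {..<5}"
  show "P5_component_graph H"
    unfolding P5_component_graph_def
  proof
    fix C assume "C \<in> connected_components H"
    then obtain u where u: "u \<in> verts H" "C = induced_subgraph H ((adjacency H)\<^sup>* `` {u})"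
      by (auto simp: connected_components_def)
    then obtain p i where p: "path_component H p" "i < 5" "u = p i"
      using cover by blast
    have C: "C = induced_subgraph H (p ` {..<5})"
      using u(2) path_component_reachable[OF p(1,2)] p(3) by simp
    have inj: "inj_on p {..<5}" and sub: "p ` {..<5} \<subseteq> verts H"
      using p(1) by (auto simp: path_component_def)
    have verts_C: "verts C = p ` {..<5}"
      using sub by (auto simp: C induced_subgraph_def)
    define f where "f = inv_into {..<5} p"
    have f_p: "f (p j) = j" if "j < 5" for j
      unfolding f_def using inj that by simp
    show "graph_isomorphic C (path_graph 5)"
      unfolding graph_isomorphic_def
    proof (intro exI[of _ f] conjI ballI)
      show "bij_betw f (verts C) (verts (path_graph 5))"
        unfolding f_def verts_C using bij_betw_inv_into[OF inj_on_imp_bij_betw[OF inj]]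
        by (simp add: path_graph_def)
      fix v w assume "v \<in> verts C" "w \<in> verts C"
      then obtain j k where jk: "j < 5" "v = p j" "k < 5" "w = p k"
        by (auto simp: verts_C)
      have "{v, w} \<in> edges C \<longleftrightarrow> {p j, p k} \<in> edges H"
        using jk by (auto simp: C induced_subgraph_def)
      also have "\<dots> \<longleftrightarrow> k = Suc j \<or> j = Suc k"
        using path_component_edge[OF p(1) jk(1), of "p k"] inj_onD[OF inj] jk by auto
      also have "\<dots> \<longleftrightarrow> {f v, f w} \<in> edges (path_graph 5)"
        using jk f_p path_graph_edge by metis
      finally show "{v, w} \<in> edges C \<longleftrightarrow> {f v, f w} \<in> edges (path_graph 5)" .
    qed
  qed
qed

text \<open>
  The set \<open>C\<close> indexes the removed path components, and \<open>D\<close> contains every modulator vertex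
  adjacent to a non-middle vertex of one of them. The matching \<open>m\<close> of \<open>D\<close> into \<open>C\<close> makes it
  possible to cover \<open>D\<close> and all removed middle vertices with two edges per component.
\<close>

locale path_crown =
  fixes G :: "'a graph" and X D :: "'a set" and C :: "'c set"
    and p :: "'c \<Rightarrow> nat \<Rightarrow> 'a" and m :: "'a \<Rightarrow> 'c"
  assumes simple: "simple_graph G"
    and finite_C: "finite C"
    and D_subset: "D \<subseteq> X"
    and component: "c \<in> C \<Longrightarrow> path_component (delete_vertices G X) (p c)"
    and disjoint: "c \<in> C \<Longrightarrow> d \<in> C \<Longrightarrow> c \<noteq> d \<Longrightarrow> p c ` {..<5} \<inter> p d ` {..<5} = {}"
    and separated: "c \<in> C \<Longrightarrow> i < 5 \<Longrightarrow> i \<noteq> 2 \<Longrightarrow> x \<in> X \<Longrightarrow> {p c i, x} \<in> edges G \<Longrightarrow> x \<in> D"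
    and inj_m: "inj_on m D"
    and matched: "x \<in> D \<Longrightarrow> m x \<in> C \<and> (\<exists>i<5. i \<noteq> 2 \<and> {p (m x) i, x} \<in> edges G)"
begin

definition removed :: "'a set" where
  "removed = D \<union> (\<Union>c\<in>C. p c ` {..<5})"

lemma path_vertex:
  assumes "c \<in> C" "i < 5"
  shows "p c i \<in> verts G" "p c i \<notin> X" "p c i \<in> removed"
  using component[OF assms(1)] assms by (auto simp: path_component_def removed_def)

lemma path_vertex_eq: "c \<in> C \<Longrightarrow> i < 5 \<Longrightarrow> j < 5 \<Longrightarrow> p c i = p c j \<longleftrightarrow> i = j"
  using component[of c] by (auto simp: path_component_def inj_on_def)

lemma path_edge:
  assumes "c \<in> C" "i < 5" "j < 5" "j = Suc i \<or> i = Suc j"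
  shows "{p c i, p c j} \<in> edges G"
  using path_component_edge[OF component[OF assms(1)] assms(2), of "p c j"] assms
  by (auto simp: edges_delete)

lemma edge_at_path:
  assumes "c \<in> C" "i < 5" "{p c i, w} \<in> edges G" "w \<notin> X"
  obtains j where "j < 5" "w = p c j" "j = Suc i \<or> i = Suc j"
proof -
  have "{p c i, w} \<in> edges (delete_vertices G X)"
    using assms path_vertex[OF assms(1,2)] simple_graph_edge_verts[OF simple assms(3)]
    by (simp add: edges_delete)
  then show ?thesis
    using that path_component_edge[OF component[OF assms(1)] assms(2), of w] by blast
qed

section \<open>Two edges per removed component are necessary\<close>

definition inner_edges :: "'a set set \<Rightarrow> 'c \<Rightarrow> 'a set set" where
  "inner_edges F c = {f \<in> F. f \<subseteq> removed \<and> (\<exists>i<5. i \<noteq> 2 \<and> p c i \<in> f)}"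

text \<open>The other end of an edge at a non-middle vertex lies on the same path or, by
  \<open>separated\<close>, in \<open>D\<close>.\<close>

lemma inner_edgesI:
  assumes F: "F \<subseteq> edges G" and "f \<in> F" "c \<in> C" "i < 5" "i \<noteq> 2" "p c i \<in> f"
  shows "f \<in> inner_edges F c"
proof -
  have f: "f \<in> edges G" using assms by auto
  then obtain w where w: "f = {p c i, w}"
    using simple_graph_edge_other[OF simple f assms(6)] by metis
  have "w \<in> removed"
  proof (cases "w \<in> X")
    case True
    then show ?thesis
      using separated[OF assms(3-5)] f w by (auto simp: removed_def)
  next
    case False
    then show ?thesis
      using edge_at_path[OF assms(3,4)] f w path_vertex(3)[OF assms(3)] by metis
  qed
  then show ?thesis
    using assms path_vertex(3)[OF assms(3,4)] w by (auto simp: inner_edges_def)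
qed

text \<open>Dominating the first and the last edge of the path takes an edge at one of its first two
  vertices and one at one of its last two. These edges differ because no edge joins the two pairs.
  Indices start at 0, so the middle vertex has index 2.\<close>

lemma two_inner_edges:
  assumes F: "edge_dominating_set G F" and c: "c \<in> C"
  shows "2 \<le> card (inner_edges F c)"
proof -
  have FG: "F \<subseteq> edges G" using F by (simp add: edge_dominating_set_def)
  have dominated: "\<exists>f\<in>F. e \<inter> f \<noteq> {}" if "e \<in> edges G" for e
    using F that by (auto simp: edge_dominating_set_def)
  obtain f where f: "f \<in> F" "{p c 0, p c 1} \<inter> f \<noteq> {}"
    using dominated[OF path_edge[OF c, of 0 1]] by auto
  obtain g where g: "g \<in> F" "{p c 3, p c 4} \<inter> g \<noteq> {}"
    using dominated[OF path_edge[OF c, of 3 4]] by auto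
  obtain i where i: "i < 5" "i < 2" "p c i \<in> f" using f(2) that[of 0] that[of 1] by auto
  obtain k where k: "k < 5" "2 < k" "p c k \<in> g" using g(2) that[of 3] that[of 4] by auto
  have "f \<noteq> g"
  proof
    assume "f = g"
    have "f \<in> edges G" using f FG by auto
    then obtain w where "f = {p c i, w}"
      using simple_graph_edge_other[OF simple _ i(3)] by metis
    then have "{p c i, p c k} \<in> edges G"
      using \<open>f \<in> edges G\<close> \<open>f = g\<close> k i path_vertex_eq[OF c i(1) k(1)] by auto
    then obtain j where "j < 5" "p c k = p c j" "j = Suc i \<or> i = Suc j"
      using edge_at_path[OF c i(1) _ path_vertex(2)[OF c k(1)]] by metis
    then show False
      using path_vertex_eq[OF c k(1)] i k by auto
  qed
  moreover have "f \<in> inner_edges F c" "g \<in> inner_edges F c"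
    using inner_edgesI[OF FG f(1) c i(1) _ i(3)] inner_edgesI[OF FG g(1) c k(1) _ k(3)] i k by auto
  moreover have "finite (inner_edges F c)"
    using finite_eds[OF simple F] by (simp add: inner_edges_def)
  ultimately show ?thesis
    using card_mono[of "inner_edges F c" "{f, g}"] by simp
qed

text \<open>A common edge would join two different components of \<open>G - X\<close>, so no edge is
  counted for two components.\<close>

lemma inner_edges_disjoint:
  assumes F: "F \<subseteq> edges G" and "c \<in> C" "d \<in> C" "c \<noteq> d"
  shows "inner_edges F c \<inter> inner_edges F d = {}"
proof (rule ccontr)
  assume "\<not> ?thesis"
  then obtain f i j where f: "f \<in> edges G" "i < 5" "j < 5" "p c i \<in> f" "p d j \<in> f"
    using F by (auto simp: inner_edges_def)
  have neq: "p c k \<noteq> p d j" if "k < 5" for k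
    using disjoint[OF assms(2-4)] that f(3) by blast
  then have "{p c i, p d j} \<in> edges G"
    using simple_graph_edge_other[OF simple f(1,4)] f by (metis insertE singletonD)
  then show False
    using edge_at_path[OF assms(2) f(2), of "p d j"] path_vertex(2)[OF assms(3) f(3)] neq by metis
qed

lemma card_inner_edges:
  assumes F: "edge_dominating_set G F"
  shows "2 * card C \<le> card {f \<in> F. f \<subseteq> removed}"
proof -
  have FG: "F \<subseteq> edges G" and fin: "finite F"
    using F finite_eds[OF simple F] by (auto simp: edge_dominating_set_def)
  have "2 * card C = (\<Sum>c\<in>C. 2)" by simp
  also have "\<dots> \<le> (\<Sum>c\<in>C. card (inner_edges F c))"
    using two_inner_edges[OF F] by (intro sum_mono)
  also have "\<dots> = card (\<Union>c\<in>C. inner_edges F c)"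
    using finite_C fin inner_edges_disjoint[OF FG]
    by (subst card_UN_disjoint) (auto simp: inner_edges_def)
  also have "\<dots> \<le> card {f \<in> F. f \<subseteq> removed}"
    using fin by (intro card_mono) (auto simp: inner_edges_def)
  finally show ?thesis .
qed

section \<open>Two edges per removed component are sufficient\<close>

definition covers :: "'c \<Rightarrow> 'a set set \<Rightarrow> bool" where
  "covers c Q \<longleftrightarrow> Q \<subseteq> edges G \<and> card Q \<le> 2 \<and> p c 2 \<in> \<Union>Q \<and>
     (\<forall>i<4. p c i \<in> \<Union>Q \<or> p c (Suc i) \<in> \<Union>Q) \<and> (\<forall>x\<in>D. m x = c \<longrightarrow> x \<in> \<Union>Q)"

lemma all_less_4: "(\<forall>i<4. P i) \<longleftrightarrow> P 0 \<and> P 1 \<and> P 2 \<and> P (3 :: nat)"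
  by (auto simp: numeral_eq_Suc less_Suc_eq)

lemma covers_exists:
  assumes c: "c \<in> C"
  shows "\<exists>Q. covers c Q"
proof (cases "c \<in> m ` D")
  case True
  then obtain x where x: "x \<in> D" "m x = c" by auto
  then obtain i where i: "i < 5" "i \<noteq> 2" "{p c i, x} \<in> edges G"
    using matched by blast
  \<comment> \<open>One edge joins the matched vertex to the path; the other joins the middle vertex
    to its neighbour on the far side from \<open>p c i\<close>. Thus the middle vertex and all four
    path edges are taken care of.\<close>
  define j where "j = (if i < 2 then 2 else 1 :: nat)"
  let ?Q = "{{p c i, x}, {p c j, p c (Suc j)}}"
  have 1: "?Q \<subseteq> edges G"
    using i path_edge[OF c, of j "Suc j"] by (auto simp: j_def)
  have 2: "card ?Q \<le> 2"
    by (rule order.trans[OF card_insert_le_m1]) auto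
  have "i = 0 \<or> i = 1 \<or> i = 3 \<or> i = 4"
    using i by auto
  then have 3: "p c 2 \<in> \<Union>?Q \<and> (\<forall>i<4. p c i \<in> \<Union>?Q \<or> p c (Suc i) \<in> \<Union>?Q)"
    unfolding all_less_4 by (auto simp: j_def numeral_eq_Suc)
  have 4: "\<forall>y\<in>D. m y = c \<longrightarrow> y \<in> \<Union>?Q"
    using x inj_onD[OF inj_m] by auto
  from 3 show ?thesis
    unfolding covers_def by (intro exI[of _ ?Q] conjI 1 2 4) (erule conjunct1 conjunct2)+
next
  case False
  let ?Q = "{{p c 1, p c 2}, {p c 2, p c 3}}"
  have 1: "?Q \<subseteq> edges G"
    using path_edge[OF c, of 1 2] path_edge[OF c, of 2 3] by auto
  have 2: "card ?Q \<le> 2"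
    by (rule order.trans[OF card_insert_le_m1]) auto
  have 3: "p c 2 \<in> \<Union>?Q \<and> (\<forall>i<4. p c i \<in> \<Union>?Q \<or> p c (Suc i) \<in> \<Union>?Q)"
    unfolding all_less_4 by (auto simp: numeral_eq_Suc)
  have 4: "\<forall>y\<in>D. m y = c \<longrightarrow> y \<in> \<Union>?Q"
    using False by auto
  from 3 show ?thesis
    unfolding covers_def by (intro exI[of _ ?Q] conjI 1 2 4) (erule conjunct1 conjunct2)+
qed

lemma removed_edge_covered:
  assumes Q: "\<And>c. c \<in> C \<Longrightarrow> covers c (Q c)"
    and e: "e \<in> edges G" "\<not> e \<subseteq> verts G - removed"
  shows "\<exists>f\<in>\<Union>(Q ` C). e \<inter> f \<noteq> {}"
proof -
  have D: "y \<in> \<Union>(\<Union>(Q ` C))" if "y \<in> D" for y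
    using Q[of "m y"] matched[OF that] that unfolding covers_def by blast
  obtain v where v: "v \<in> e" "v \<in> removed"
    using e edge_subset_verts[OF simple e(1)] by auto
  show ?thesis
  proof (cases "e \<inter> D = {}")
    case False
    then show ?thesis using D by blast
  next
    case True
    then obtain c i where c: "c \<in> C" "i < 5" "v = p c i"
      using v by (auto simp: removed_def)
    obtain w where w: "e = {v, w}"
      using simple_graph_edge_other[OF simple e(1) v(1)] by metis
    have Qc: "covers c (Q c)" using Q c by simp
    have "v \<in> \<Union>(Q c) \<or> w \<in> \<Union>(Q c)"
    proof (cases "w \<in> X")
      \<comment> \<open>Only the middle vertex can have neighbours in \<open>X\<close> outside
        \<open>D\<close>; for this reason \<open>covers\<close> insists on it.\<close>
      case wX: True
      then have "i = 2"
        using separated[OF c(1,2) _ wX] e(1) w c(3) True by auto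
      then show ?thesis using Qc c(3) by (simp add: covers_def)
    next
      case False
      then obtain j where "j < 5" "w = p c j" "j = Suc i \<or> i = Suc j"
        using edge_at_path[OF c(1,2)] e(1) w c(3) by metis
      then show ?thesis
        using Qc c(2,3) unfolding covers_def by (metis Suc_less_eq eval_nat_numeral(3) numeral_eq_Suc semiring_norm(28))
    qed
    then show ?thesis using w c(1) by blast
  qed
qed

lemma has_eds_lift:
  assumes "has_eds (delete_vertices G removed) k"
  shows "has_eds G (k + 2 * card C)"
proof -
  let ?H = "delete_vertices G removed"
  obtain F where F: "edge_dominating_set ?H F" "card F \<le> k"
    using assms unfolding has_eds_def by blast
  obtain Q where Q: "\<And>c. c \<in> C \<Longrightarrow> covers c (Q c)"
    using covers_exists by metis
  have "edge_dominating_set G (F \<union> \<Union>(Q ` C))"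
    unfolding edge_dominating_set_def
  proof (intro conjI ballI)
    show "F \<union> \<Union>(Q ` C) \<subseteq> edges G"
      using F(1) Q by (auto simp: edge_dominating_set_def edges_delete covers_def)
    fix e assume e: "e \<in> edges G"
    show "\<exists>f\<in>F \<union> \<Union>(Q ` C). e \<inter> f \<noteq> {}"
    proof (cases "e \<subseteq> verts G - removed")
      case True
      then have "e \<in> edges ?H" using e by (simp add: edges_delete)
      then obtain f where "f \<in> F" "e \<inter> f \<noteq> {}"
        using F(1) unfolding edge_dominating_set_def by blast
      then show ?thesis by blast
    next
      case False
      then show ?thesis using removed_edge_covered[OF Q e] by blast
    qed
  qed
  moreover have "card (F \<union> \<Union>(Q ` C)) \<le> k + 2 * card C"
  proof -
    have "card (\<Union>(Q ` C)) \<le> (\<Sum>c\<in>C. card (Q c))"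
      using finite_C by (rule card_UN_le)
    also have "\<dots> \<le> (\<Sum>c\<in>C. 2)"
      using Q by (intro sum_mono) (simp add: covers_def)
    finally show ?thesis
      using F(2) card_Un_le[of F "\<Union>(Q ` C)"] by simp
  qed
  ultimately show ?thesis
    unfolding has_eds_def by blast
qed

text \<open>Subtraction on \<open>nat\<close> truncates, so the lower bound on \<open>k\<close> has
  to be part of the equivalence.\<close>

theorem has_eds_iff:
  "has_eds G k \<longleftrightarrow> 2 * card C \<le> k \<and> has_eds (delete_vertices G removed) (k - 2 * card C)"
proof
  assume "has_eds G k"
  then obtain F where F: "edge_dominating_set G F" "card F \<le> k"
    unfolding has_eds_def by blast
  have "card {f \<in> F. f \<subseteq> removed} \<le> card F"
    using finite_eds[OF simple F(1)] by (intro card_mono) auto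
  then have "2 * card C \<le> k" "card F - card {f \<in> F. f \<subseteq> removed} \<le> k - 2 * card C"
    using card_inner_edges[OF F(1)] F(2) by linarith+
  then show "2 * card C \<le> k \<and> has_eds (delete_vertices G removed) (k - 2 * card C)"
    using eds_delete_vertices[OF simple F(1), of removed] has_eds_mono by blast
next
  assume "2 * card C \<le> k \<and> has_eds (delete_vertices G removed) (k - 2 * card C)"
  then show "has_eds G k"
    using has_eds_lift[of "k - 2 * card C"] by simp
qed

end

section \<open>Induced subgraphs with renumbered vertices\<close>

text \<open>Instances have vertices numbered from 0, so a kept vertex is renamed to its position in
  \<open>vs\<close>.\<close>

definition relabel :: "nat graph \<Rightarrow> nat list \<Rightarrow> nat graph" where
  "relabel G vs = \<lparr>verts = {..<length vs},
     edges = {{i, j} | i j. i < length vs \<and> j < length vs \<and> {vs ! i, vs ! j} \<in> edges G}\<rparr>"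

lemma verts_relabel [simp]: "verts (relabel G vs) = {..<length vs}"
  by (simp add: relabel_def)

lemma edge_relabel:
  "{i, j} \<in> edges (relabel G vs) \<longleftrightarrow> i < length vs \<and> j < length vs \<and> {vs ! i, vs ! j} \<in> edges G"
  by (auto simp: relabel_def doubleton_eq_iff insert_commute)

lemma simple_graph_relabel:
  assumes "simple_graph G"
  shows "simple_graph (relabel G vs)"
  unfolding simple_graph_def
proof (intro conjI ballI)
  fix e assume "e \<in> edges (relabel G vs)"
  then obtain i j where e: "e = {i, j}" "i < length vs" "j < length vs" "{vs ! i, vs ! j} \<in> edges G"
    by (auto simp: relabel_def)
  then show "\<exists>u\<in>verts (relabel G vs). \<exists>v\<in>verts (relabel G vs). u \<noteq> v \<and> e = {u, v}"
    using simple_graph_edge_verts(3)[OF assms e(4)] e by (intro bexI[of _ i] bexI[of _ j]) auto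
qed simp

lemma has_eds_relabel:
  assumes G: "simple_graph G" and vs: "distinct vs" "set vs = verts G - S"
  shows "has_eds (relabel G vs) k \<longleftrightarrow> has_eds (delete_vertices G S) k"
proof (rule has_eds_image[symmetric])
  show "simple_graph (relabel G vs)"
    using G by (rule simple_graph_relabel)
  show "inj_on ((!) vs) (verts (relabel G vs))"
    using vs(1) by (auto simp: inj_on_def nth_eq_iff_index_eq)
  show "edges (delete_vertices G S) = (`) ((!) vs) ` edges (relabel G vs)"
  proof (intro equalityI subsetI)
    fix e assume "e \<in> edges (delete_vertices G S)"
    then have e: "e \<in> edges G" "e \<subseteq> set vs"
      by (auto simp: edges_delete vs)
    then obtain u v where uv: "e = {u, v}"
      using simple_graph_edgeE[OF G] by metis
    then obtain i j where "i < length vs" "j < length vs" "u = vs ! i" "v = vs ! j"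
      using e(2) by (auto simp: in_set_conv_nth)
    then show "e \<in> (`) ((!) vs) ` edges (relabel G vs)"
      using e(1) uv by (intro image_eqI[of _ _ "{i, j}"]) (auto simp: edge_relabel)
  next
    fix e assume "e \<in> (`) ((!) vs) ` edges (relabel G vs)"
    then obtain i j where "i < length vs" "j < length vs" "{vs ! i, vs ! j} \<in> edges G" "e = {vs ! i, vs ! j}"
      by (auto simp: relabel_def)
    then show "e \<in> edges (delete_vertices G S)"
      using nth_mem[of i vs] nth_mem[of j vs] by (auto simp: edges_delete vs)
  qed
qed

section \<open>Correctness of the kernelization\<close>

definition input_of :: "eds_instance \<Rightarrow> input" where
  "input_of I = (let vs = [0..<card (verts (graph I))] in
     (map (\<lambda>u. map (\<lambda>v. {u, v} \<in> edges (graph I)) vs) vs, map (\<lambda>v. v \<in> modulator I) vs))"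

lemma near_adj: "near a c u \<Longrightarrow> \<exists>v. adj a c v"
  by (auto simp: near_def list_ex_iff)

locale eds_input =
  fixes I :: eds_instance
  assumes instance_I: "I \<in> eds_instances"
begin

abbreviation "G \<equiv> graph I"
abbreviation "X \<equiv> modulator I"
abbreviation "n \<equiv> card (verts G)"
abbreviation "H \<equiv> delete_vertices G X"
abbreviation "a \<equiv> input_of I"
abbreviation "ps \<equiv> auction a"

lemma simple: "simple_graph G"
  using instance_I by (simp add: eds_instances_def)

lemma verts_G: "verts G = {..<n}"
  using instance_I by (auto simp: eds_instances_def)

lemma in_verts_G: "u \<in> verts G \<longleftrightarrow> u < n"
  by (subst verts_G) simp

lemma X_subset: "X \<subseteq> {..<n}"
  using instance_I verts_G by (simp add: eds_instances_def)

lemma simple_H: "simple_graph H"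
  using simple by (rule simple_graph_delete)

lemma length_a [simp]: "length (snd a) = n"
  by (simp add: input_of_def Let_def)

lemma adj_a [simp]: "adj a u v \<longleftrightarrow> {u, v} \<in> edges G"
  using simple_graph_edge_verts[OF simple, of u v] verts_G
  by (auto simp: adj_def input_of_def Let_def entry_eq)

lemma in_mod_a [simp]: "in_mod a u \<longleftrightarrow> u \<in> X"
  using X_subset by (auto simp: in_mod_def input_of_def Let_def entry_eq)

lemma edge_H: "{u, v} \<in> edges H \<longleftrightarrow> {u, v} \<in> edges G \<and> u \<notin> X \<and> v \<notin> X"
  using simple_graph_edge_verts[OF simple, of u v] by (auto simp: edges_delete)

lemma path_cover:
  assumes "u < n" "u \<notin> X"
  obtains p i where "path_component H p" "i < 5" "u = p i"
proof -
  have "P5_component_graph H" "u \<in> verts H"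
    using instance_I assms verts_G by (auto simp: eds_instances_def)
  then show ?thesis
    using that P5_component_graph_iff[OF simple_H] by blast
qed

section \<open>Recognizing the paths by counting near vertices\<close>

lemma path_vertex_H:
  assumes "path_component H p" "i < 5"
  shows "p i < n" "p i \<notin> X"
  using assms verts_G by (auto simp: path_component_def)

lemma path_inj:
  "path_component H p \<Longrightarrow> i < 5 \<Longrightarrow> j < 5 \<Longrightarrow> p i = p j \<longleftrightarrow> i = j"
  by (auto simp: path_component_def inj_on_def)

lemma near_path:
  assumes p: "path_component H p" and i: "i < 5"
  shows "near a (p i) u \<longleftrightarrow> (\<exists>j<5. u = p j \<and> j \<noteq> i \<and> j \<le> i + 2 \<and> i \<le> j + 2)"
proof -
  have less: "w < n" if "{v, w} \<in> edges G" for v w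
    using simple_graph_edge_verts(2)[OF simple that] verts_G by blast
  have two_steps: "(\<exists>w. {p i, w} \<in> edges H \<and> {w, u} \<in> edges H) \<longleftrightarrow>
      (\<exists>k<5. (k = Suc i \<or> i = Suc k) \<and> (\<exists>j<5. u = p j \<and> (j = Suc k \<or> k = Suc j)))"
    unfolding path_component_edge[OF p i] using path_component_edge[OF p, of _ u] by blast
  have "near a (p i) u \<longleftrightarrow> u \<noteq> p i \<and> u \<notin> X \<and>
      ({p i, u} \<in> edges G \<or> (\<exists>w<n. w \<notin> X \<and> {p i, w} \<in> edges G \<and> {w, u} \<in> edges G))"
    by (auto simp: near_def list_ex_iff)
  also have "\<dots> \<longleftrightarrow> u \<noteq> p i \<and> ({p i, u} \<in> edges H \<or> (\<exists>w. {p i, w} \<in> edges H \<and> {w, u} \<in> edges H))"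
    unfolding edge_H using path_vertex_H(2)[OF p i] less by blast
  also have "\<dots> \<longleftrightarrow> (\<exists>j<5. u = p j \<and> j \<noteq> i \<and> ((j = Suc i \<or> i = Suc j) \<or>
      (\<exists>k<5. (k = Suc i \<or> i = Suc k) \<and> (j = Suc k \<or> k = Suc j))))"
    (is "?L \<longleftrightarrow> (\<exists>j<5. u = p j \<and> j \<noteq> i \<and> ?R j)")
  proof
    assume ?L
    then obtain j where j: "j < 5" "u = p j" "?R j"
      unfolding two_steps unfolding path_component_edge[OF p i] by blast
    have "u \<noteq> p i" using \<open>?L\<close> by (rule conjunct1)
    then have "j \<noteq> i" using j(2) by blast
    with j show "\<exists>j<5. u = p j \<and> j \<noteq> i \<and> ?R j"
      by (intro exI[of _ j] conjI)
  next
    assume "\<exists>j<5. u = p j \<and> j \<noteq> i \<and> ?R j"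
    then obtain j where "j < 5" "u = p j" "j \<noteq> i" "?R j" by blast
    note j = this
    have "u \<noteq> p i"
      using path_inj[OF p j(1) i] j(2,3) by simp
    moreover from j have "{p i, u} \<in> edges H \<or> (\<exists>w. {p i, w} \<in> edges H \<and> {w, u} \<in> edges H)"
      unfolding two_steps unfolding path_component_edge[OF p i] by blast
    ultimately show ?L by (rule conjI)
  qed
  also have "\<dots> \<longleftrightarrow> (\<exists>j<5. u = p j \<and> j \<noteq> i \<and> j \<le> i + 2 \<and> i \<le> j + 2)"
  proof -
    have "?R j \<longleftrightarrow> j \<le> i + 2 \<and> i \<le> j + 2" if j: "j < 5" "j \<noteq> i" for j
    proof -
      have "(\<exists>k<5. (k = Suc i \<or> i = Suc k) \<and> (j = Suc k \<or> k = Suc j)) \<longleftrightarrow> j = i + 2 \<or> i = j + 2"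
      proof
        assume "j = i + 2 \<or> i = j + 2"
        then show "\<exists>k<5. (k = Suc i \<or> i = Suc k) \<and> (j = Suc k \<or> k = Suc j)"
        proof
          assume "j = i + 2"
          then show ?thesis using j by (intro exI[of _ "Suc i"]) simp
        next
          assume "i = j + 2"
          then show ?thesis using i by (intro exI[of _ "Suc j"]) simp
        qed
      qed (use j in auto)
      moreover have "(j = Suc i \<or> i = Suc j) \<or> (j = i + 2 \<or> i = j + 2) \<longleftrightarrow> j \<le> i + 2 \<and> i \<le> j + 2"
        using j(2) by linarith
      ultimately show ?thesis by (simp only:)
    qed
    then show ?thesis
      by (intro arg_cong[where f = Ex] ext conj_cong refl)
  qed
  finally show ?thesis .
qed

text \<open>Along a path on five vertices the numbers of other vertices within distance two are 2,
  3, 4, 3, 2.\<close>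

lemma centre_path:
  assumes p: "path_component H p" and i: "i < 5"
  shows "centre a (p i) \<longleftrightarrow> i = 2"
proof -
  let ?P = "\<lambda>j. j \<noteq> i \<and> j \<le> i + 2 \<and> i \<le> j + 2"
  have "{u. u < n \<and> near a (p i) u} = p ` {j. j < 5 \<and> ?P j}"
    using near_path[OF p i] path_vertex_H(1)[OF p] by auto
  moreover have "length (filter (near a (p i)) (vertex_list a)) = card {u. u < n \<and> near a (p i) u}"
    by (subst distinct_length_filter) (auto simp: vertex_list_def Int_def conj_commute)
  moreover have "card (p ` {j. j < 5 \<and> ?P j}) = card {j. j < 5 \<and> ?P j}"
    using path_inj[OF p] by (intro card_image) (auto simp: inj_on_def)
  moreover have "card {j. j < 5 \<and> ?P j} = length (filter ?P [0..<5])"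
    by (subst distinct_length_filter) (auto intro: arg_cong[of _ _ card])
  moreover have "[0..<5] = [0, 1, 2, 3, 4 :: nat]"
    by (simp add: upt_rec)
  moreover have "i = 0 \<or> i = 1 \<or> i = 2 \<or> i = 3 \<or> i = 4"
    using i by auto
  ultimately show ?thesis
    using path_vertex_H(2)[OF p i] by (auto simp: centre_def)
qed

text \<open>A path has two enumerations with \<open>c\<close> in the middle, each the reverse of the
  other; either choice will do.\<close>

definition path :: "nat \<Rightarrow> nat \<Rightarrow> nat" where
  "path c = (SOME p. path_component H p \<and> p 2 = c)"

text \<open>A centre has a near vertex and therefore a neighbour, so it is a vertex of the
  graph.\<close>

lemma centre_less: "centre a c \<Longrightarrow> c < n" "centre a c \<Longrightarrow> c \<notin> X"
proof -
  assume c: "centre a c"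
  then show "c \<notin> X" by (simp add: centre_def)
  have "filter (near a c) (vertex_list a) \<noteq> []"
    using c by (auto simp: centre_def)
  then obtain u where "near a c u"
    by (auto simp: filter_empty_conv)
  then obtain v where "adj a c v"
    using near_adj by blast
  then have "{c, v} \<in> edges G" by simp
  then show "c < n"
    using simple_graph_edge_verts(1)[OF simple] verts_G by auto
qed

lemma path:
  assumes "centre a c"
  shows "path_component H (path c)" "path c 2 = c"
proof -
  obtain p i where p: "path_component H p" "i < 5" "c = p i"
    using path_cover centre_less[OF assms] by metis
  then have "path_component H p \<and> p 2 = c"
    using centre_path[OF p(1,2)] assms by simp
  then have "path_component H (path c) \<and> path c 2 = c"
    unfolding path_def by (rule someI[of "\<lambda>p. path_component H p \<and> p 2 = c"])
  then show "path_component H (path c)" "path c 2 = c" by blast+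
qed

lemma path_unique:
  assumes "centre a c" "path_component H p" "i < 5" "j < 5" "path c i = p j"
  shows "p 2 = c"
proof -
  have "path c ` {..<5} = p ` {..<5}"
    using path_component_reachable[OF path(1)[OF assms(1)] assms(3)]
      path_component_reachable[OF assms(2,4)] assms(5) by simp
  moreover have "c \<in> path c ` {..<5}"
    using path(2)[OF assms(1)] by (intro image_eqI[of _ _ 2]) auto
  ultimately obtain k where "k < 5" "c = p k" by auto
  then show ?thesis
    using centre_path[OF assms(2)] assms(1) by auto
qed

lemma centre_cover:
  assumes "u < n" "u \<notin> X"
  obtains c i where "centre a c" "i < 5" "u = path c i"
proof -
  obtain p i where p: "path_component H p" "i < 5" "u = p i"
    using path_cover assms by metis
  have c: "centre a (p 2)"
    using centre_path[OF p(1), of 2] by simp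
  have "path (p 2) ` {..<5} = p ` {..<5}"
    using path_component_reachable[OF path(1)[OF c], of 2] path_component_reachable[OF p(1), of 2]
      path(2)[OF c] by simp
  then obtain j where "j < 5" "u = path (p 2) j"
    using p by (metis imageE imageI lessThan_iff)
  then show ?thesis using that c by blast
qed

lemma path_eq:
  assumes "centre a c" "centre a d" "i < 5" "j < 5" "path c i = path d j"
  shows "c = d"
  using path_unique[OF assms(1) path(1)[OF assms(2)] assms(3-5)] path(2)[OF assms(2)] by simp

lemma near_centre:
  assumes "centre a c"
  shows "near a c u \<longleftrightarrow> (\<exists>i<5. i \<noteq> 2 \<and> u = path c i)"
proof -
  have "i \<le> 2 + 2 \<and> 2 \<le> i + 2 \<longleftrightarrow> i < 5" for i :: nat by auto
  then show ?thesis
    using near_path[OF path(1)[OF assms], of 2 u] path(2)[OF assms] by auto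
qed

lemma linked_centre:
  assumes "centre a c"
  shows "linked a c x \<longleftrightarrow> x \<in> X \<and> (\<exists>i<5. i \<noteq> 2 \<and> {path c i, x} \<in> edges G)"
  using path_vertex_H(1)[OF path(1)[OF assms]] near_centre[OF assms]
  by (fastforce simp: linked_def list_ex_iff)

section \<open>The deleted and the kept vertices\<close>

definition C :: "nat set" where
  "C = {c. centre a c \<and> \<not> kept_centre a ps c}"

definition D :: "nat set" where
  "D = {x \<in> X. \<not> cheap a ps x}"

lemma path_crown: "\<exists>m. path_crown G X D C path m"
proof (rule removed_matching[of a])
  fix m
  assume inj: "inj_on m {x. in_mod a x \<and> \<not> cheap a ps x}"
    and m: "\<And>x. in_mod a x \<Longrightarrow> \<not> cheap a ps x \<Longrightarrow>
      m x < length (snd a) \<and> centre a (m x) \<and> \<not> kept_centre a ps (m x) \<and> linked a (m x) x"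
  have "path_crown G X D C path m"
  proof
    show "simple_graph G" by (rule simple)
    show "finite C"
      using centre_less(1) by (intro finite_subset[of C "{..<n}"]) (auto simp: C_def)
    show "D \<subseteq> X" by (auto simp: D_def)
    show "path_component (delete_vertices G X) (path c)" if "c \<in> C" for c
      using that path(1) by (simp add: C_def)
    show "path c ` {..<5} \<inter> path d ` {..<5} = {}" if "c \<in> C" "d \<in> C" "c \<noteq> d" for c d
    proof (rule ccontr)
      assume "\<not> ?thesis"
      then obtain i j where "i < 5" "j < 5" "path c i = path d j" by auto
      then show False using path_eq that by (auto simp: C_def)
    qed
    show "x \<in> D" if "c \<in> C" "i < 5" "i \<noteq> 2" "x \<in> X" "{path c i, x} \<in> edges G" for c i x
    proof -
      have c: "centre a c" "\<not> kept_centre a ps c" using that(1) by (auto simp: C_def)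
      then have "linked a c x" using linked_centre that by blast
      then show ?thesis
        using removed_not_linked_cheap[of c a x] c centre_less(1) that(4) by (simp add: D_def)
    qed
    show "inj_on m D" using inj by (simp add: D_def)
    show "m x \<in> C \<and> (\<exists>i<5. i \<noteq> 2 \<and> {path (m x) i, x} \<in> edges G)" if "x \<in> D" for x
    proof -
      have "centre a (m x)" "\<not> kept_centre a ps (m x)" "linked a (m x) x"
        using m[of x] that by (auto simp: D_def)
      then show ?thesis
        using linked_centre by (simp add: C_def)
    qed
  qed
  then show "\<exists>m. path_crown G X D C path m" by (intro exI[of _ m])
qed

definition deleted :: "nat set" where
  "deleted = D \<union> (\<Union>c\<in>C. path c ` {..<5})"

lemma has_eds_reduction:
  "has_eds G k \<longleftrightarrow> 2 * card C \<le> k \<and> has_eds (delete_vertices G deleted) (k - 2 * card C)"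
proof -
  obtain m where "path_crown G X D C path m"
    using path_crown by blast
  then interpret crown: path_crown G X D C path m .
  show ?thesis
    using crown.has_eds_iff[of k] unfolding crown.removed_def deleted_def .
qed

lemma kept_path:
  assumes c: "centre a c" and i: "i < 5"
  shows "kept a ps (path c i) \<longleftrightarrow> kept_centre a ps c"
proof
  assume "kept a ps (path c i)"
  moreover have "\<not> cheap a ps (path c i)"
    using path_vertex_H(2)[OF path(1)[OF c] i] by (simp add: cheap_def)
  ultimately consider "kept_centre a ps (path c i)"
    | d where "kept_centre a ps d" "near a d (path c i)"
    by (auto simp: kept_def list_ex_iff)
  then show "kept_centre a ps c"
  proof cases
    case 1
    then have "centre a (path c i)" by (simp add: kept_centre_def)
    then have "i = 2" using centre_path[OF path(1)[OF c] i] by simp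
    then show ?thesis using 1 path(2)[OF c] by simp
  next
    case 2
    then have d: "centre a d" by (simp add: kept_centre_def)
    then obtain j where "j < 5" "path c i = path d j"
      using 2 near_centre by blast
    then show ?thesis
      using path_eq[OF c d i] 2 by simp
  qed
next
  assume "kept_centre a ps c"
  then show "kept a ps (path c i)"
    using near_centre[OF c, of "path c i"] i path(2)[OF c] centre_less(1)[OF c]
    by (cases "i = 2") (auto simp: kept_def list_ex_iff)
qed

text \<open>Connects the test evaluated by the algorithm with the set deleted in the reduction. It
  rests on the fact that a path is kept or deleted as a whole.\<close>

lemma kept_iff:
  assumes "u < n"
  shows "kept a ps u \<longleftrightarrow> u \<notin> deleted"
proof (cases "u \<in> X")
  case True
  then have "kept a ps u \<longleftrightarrow> cheap a ps u"
    using centre_less(2)[of u] by (auto simp: kept_def list_ex_iff kept_centre_def near_def)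
  moreover have "u \<notin> path c ` {..<5}" if "c \<in> C" for c
    using path_vertex_H(2)[OF path(1)] that True by (auto simp: C_def)
  ultimately show ?thesis
    using True by (auto simp: deleted_def D_def)
next
  case False
  then obtain c i where c: "centre a c" "i < 5" "u = path c i"
    using centre_cover assms by metis
  have "u \<in> deleted \<longleftrightarrow> c \<in> C"
  proof
    assume "u \<in> deleted"
    then obtain d j where "d \<in> C" "j < 5" "u = path d j"
      using False by (auto simp: deleted_def D_def)
    then show "c \<in> C"
      using path_eq[OF c(1) _ c(2), of d j] c(3) by (auto simp: C_def)
  next
    assume "c \<in> C"
    then show "u \<in> deleted" using c by (auto simp: deleted_def)
  qed
  then show ?thesis
    using kept_path[OF c(1,2)] c by (simp add: C_def)
qed

definition vs :: "nat list" where
  "vs = filter (kept a ps) (vertex_list a)"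

lemma distinct_vs: "distinct vs"
  by (simp add: vs_def vertex_list_def)

lemma set_vs: "set vs = verts G - deleted"
  using kept_iff by (auto simp: vs_def in_verts_G)

lemma vs_less: "u \<in> set vs \<Longrightarrow> u < n"
  by (simp add: vs_def)

lemma kept_vs: "u \<in> set vs \<Longrightarrow> kept a ps u"
  by (simp add: vs_def)

lemma removed_paths_eq: "removed_paths a ps = card C"
proof -
  have "removed_paths a ps = card ({c. centre a c \<and> \<not> kept_centre a ps c} \<inter> {..<n})"
    unfolding removed_paths_def
    by (subst distinct_length_filter) (auto simp: vertex_list_def atLeast0LessThan)
  moreover have "{c. centre a c \<and> \<not> kept_centre a ps c} \<inter> {..<n} = C"
    using centre_less(1) by (auto simp: C_def)
  ultimately show ?thesis by simp
qed

text \<open>Each cheap modulator vertex accounts for itself and for the five vertices of at most one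
  kept path.\<close>

lemma length_vs: "length vs \<le> 6 * card X"
proof -
  let ?K = "{c. kept_centre a ps c}"
  have fin: "finite ?K" "finite {x. cheap a ps x}"
    using centre_less(1) X_subset
    by (auto intro!: finite_subset[of _ "{..<n}"] simp: kept_centre_def cheap_def)
  have "set vs \<subseteq> {x. cheap a ps x} \<union> (\<Union>c\<in>?K. path c ` {..<5})"
  proof
    fix u assume "u \<in> set vs"
    then have u: "u < n" "kept a ps u" by (auto simp: vs_def)
    show "u \<in> {x. cheap a ps x} \<union> (\<Union>c\<in>?K. path c ` {..<5})"
    proof (cases "u \<in> X")
      case True
      then show ?thesis
        using u centre_less(2)[of u] by (auto simp: kept_def list_ex_iff kept_centre_def near_def)
    next
      case False
      then obtain c i where "centre a c" "i < 5" "u = path c i"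
        using centre_cover u by metis
      then show ?thesis using kept_path u by auto
    qed
  qed
  then have "card (set vs) \<le> card ({x. cheap a ps x} \<union> (\<Union>c\<in>?K. path c ` {..<5}))"
    using fin by (intro card_mono) auto
  also have "\<dots> \<le> card {x. cheap a ps x} + card (\<Union>c\<in>?K. path c ` {..<5})"
    by (rule card_Un_le)
  also have "card (\<Union>c\<in>?K. path c ` {..<5}) \<le> (\<Sum>c\<in>?K. card (path c ` {..<5}))"
    using fin by (intro card_UN_le)
  also have "\<dots> \<le> (\<Sum>c\<in>?K. 5)"
    by (intro sum_mono order.trans[OF card_image_le]) auto
  also have "\<dots> \<le> 5 * card {x. cheap a ps x}"
    using card_kept_centres[of a] by simp
  also have "card {x. cheap a ps x} \<le> card X"
    using X_subset by (intro card_mono) (auto intro: finite_subset simp: cheap_def)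
  finally show ?thesis
    using distinct_card[OF distinct_vs] by simp
qed

text \<open>Kept paths are complete, so the positions of their five vertices in \<open>vs\<close>
  again enumerate a component.\<close>

lemma P5_component_graph_relabel:
  "P5_component_graph (delete_vertices (relabel G vs) {i. i < length vs \<and> vs ! i \<in> X})"
    (is "P5_component_graph ?H")
proof -
  have edge: "{i, j} \<in> edges ?H \<longleftrightarrow> i < length vs \<and> j < length vs \<and> {vs ! i, vs ! j} \<in> edges H" for i j
    by (auto simp: edges_delete[of "relabel G vs"] edge_relabel edge_H)
  show ?thesis
    unfolding P5_component_graph_iff[OF simple_graph_delete[OF simple_graph_relabel[OF simple]]]
  proof
    fix u assume "u \<in> verts ?H"
    then have u: "u < length vs" "vs ! u \<notin> X" by auto
    then have vs_u: "vs ! u \<in> set vs" by simp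
    obtain c i where c: "centre a c" "i < 5" "vs ! u = path c i"
      using centre_cover[OF vs_less[OF vs_u] u(2)] .
    then have "kept_centre a ps c"
      using kept_path[OF c(1,2)] kept_vs[OF vs_u] by simp
    then have in_vs: "path c j \<in> set vs" if "j < 5" for j
      using kept_path[OF c(1) that] path_vertex_H(1)[OF path(1)[OF c(1)] that] by (simp add: vs_def)
    define q where "q j = (SOME k. k < length vs \<and> vs ! k = path c j)" for j
    have q: "q j < length vs \<and> vs ! q j = path c j" if "j < 5" for j
      unfolding q_def by (rule someI_ex) (use in_vs[OF that] in \<open>simp add: in_set_conv_nth\<close>)
    have q_iff: "k = q j \<longleftrightarrow> vs ! k = path c j" if "j < 5" "k < length vs" for j k
      using q[OF that(1)] that(2) distinct_vs by (metis nth_eq_iff_index_eq)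
    have "path_component ?H q"
      unfolding path_component_def
    proof (intro conjI allI impI)
      show "inj_on q {..<5}"
        using q path_inj[OF path(1)[OF c(1)]] by (metis inj_onI lessThan_iff)
      show "q ` {..<5} \<subseteq> verts ?H"
        using q path_vertex_H(2)[OF path(1)[OF c(1)]] by auto
      fix j k assume j: "j < (5 :: nat)"
      show "{q j, k} \<in> edges ?H \<longleftrightarrow> (\<exists>l<5. k = q l \<and> (l = Suc j \<or> j = Suc l))"
      proof (cases "k < length vs")
        case True
        then have "{q j, k} \<in> edges ?H \<longleftrightarrow> {path c j, vs ! k} \<in> edges H"
          using q[OF j] edge by simp
        also have "\<dots> \<longleftrightarrow> (\<exists>l<5. vs ! k = path c l \<and> (l = Suc j \<or> j = Suc l))"
          by (rule path_component_edge[OF path(1)[OF c(1)] j])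
        also have "\<dots> \<longleftrightarrow> (\<exists>l<5. k = q l \<and> (l = Suc j \<or> j = Suc l))"
          using q_iff True by blast
        finally show ?thesis .
      next
        case False
        then show ?thesis using edge q by blast
      qed
    qed
    moreover have "u = q i"
      using q_iff[OF c(2) u(1)] c(3) by simp
    ultimately show "\<exists>p. path_component ?H p \<and> u \<in> p ` {..<5}"
      using c(2) by blast
  qed
qed

end

section \<open>The kernelization\<close>

definition no_instance :: eds_instance where
  "no_instance = \<lparr>graph = \<lparr>verts = {}, edges = {}\<rparr>, budget = - 1, modulator = {}\<rparr>"

definition encoded :: "eds_instance \<Rightarrow> bool list list \<times> bool list \<times> bool \<times> bool list" where
  "encoded I = (fst (input_of I), snd (input_of I), budget I < 0, binary_digits (nat \<bar>budget I\<bar>))"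

lemma encode_instance_eq: "encode_instance I = enc (encoded I)"
  by (simp add: encode_instance_def encoded_def input_of_def Let_def encode_int_def
      enc_prod_def enc_list_def enc_bool_def[abs_def])

text \<open>The counterpart of \<open>kernelize\<close> on instances. The two need to agree only on
  valid instances, where the running time is promised.\<close>

definition kernel_instance :: "eds_instance \<Rightarrow> eds_instance" where
  "kernel_instance I =
    (let a = input_of I; n = card (verts (graph I)); d = 2 * removed_paths a (auction a);
         vs = filter (kept a (auction a)) (vertex_list a); k = min n (nat (budget I))
     in if budget I < 0 \<or> k < d then no_instance
        else \<lparr>graph = relabel (graph I) vs, budget = int (min (length vs) (k - d)),
          modulator = {i. i < length vs \<and> vs ! i \<in> modulator I}\<rparr>)"

lemma encoded_no_instance: "encoded no_instance = ([], [], True, [True])"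
  using funpow_increment[of 1] by (simp add: encoded_def no_instance_def input_of_def)

lemma input_of_relabel:
  assumes "graph J = relabel G vs" "modulator J = {i. i < length vs \<and> vs ! i \<in> X}"
  shows "input_of J = (map (\<lambda>u. map (\<lambda>v. {u, v} \<in> edges G) vs) vs, map (\<lambda>v. v \<in> X) vs)"
proof -
  have "map (\<lambda>j. {i, j} \<in> edges (relabel G vs)) [0..<length vs] = map (\<lambda>v. {vs ! i, v} \<in> edges G) vs"
    if "i < length vs" for i
    using that by (intro nth_equalityI) (simp_all add: edge_relabel)
  then have "map (\<lambda>i. map (\<lambda>j. {i, j} \<in> edges (relabel G vs)) [0..<length vs]) [0..<length vs]
      = map (\<lambda>u. map (\<lambda>v. {u, v} \<in> edges G) vs) vs"
    by (intro nth_equalityI) simp_all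
  moreover have "map (\<lambda>i. i < length vs \<and> vs ! i \<in> X) [0..<length vs] = map (\<lambda>v. v \<in> X) vs"
    by (intro nth_equalityI) simp_all
  ultimately show ?thesis
    by (simp add: input_of_def Let_def assms)
qed

lemma eds_yes_iff: "eds_yes I \<longleftrightarrow> 0 \<le> budget I \<and> has_eds (graph I) (nat (budget I))"
  unfolding eds_yes_def has_eds_def by (auto simp: le_nat_iff nat_le_iff)

lemma no_instance: "no_instance \<in> eds_instances" "\<not> eds_yes no_instance"
  by (auto simp: eds_yes_iff no_instance_def eds_instances_def simple_graph_def
      P5_component_graph_def connected_components_def intro!: exI[of _ 0])

context eds_input
begin

lemma kernel_instance_eq:
  "kernel_instance I = (if budget I < 0 \<or> min n (nat (budget I)) < 2 * card C then no_instance
     else \<lparr>graph = relabel G vs, budget = int (min (length vs) (min n (nat (budget I)) - 2 * card C)),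
       modulator = {i. i < length vs \<and> vs ! i \<in> X}\<rparr>)"
  by (simp add: kernel_instance_def Let_def removed_paths_eq vs_def)

lemma encoded_kernel_instance: "encoded (kernel_instance I) = kernelize (encoded I)"
proof -
  \<comment> \<open>For a negative budget the digits are those of the absolute value, but then the
    sign alone decides the output.\<close>
  have k: "capped_value n (binary_digits (nat \<bar>budget I\<bar>)) = min n (nat (budget I))" if "0 \<le> budget I"
    using that by (simp add: capped_value_binary_digits)
  have adj: "adj a u = (\<lambda>v. {u, v} \<in> edges G)" and in_mod: "in_mod a = (\<lambda>v. v \<in> X)" for u
    by auto
  have a: "(fst (encoded I), fst (snd (encoded I))) = a" "fst (snd (snd (encoded I))) \<longleftrightarrow> budget I < 0"
    "snd (snd (snd (encoded I))) = binary_digits (nat \<bar>budget I\<bar>)"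
    by (simp_all add: encoded_def)
  have kernelize: "kernelize (encoded I) =
      (if budget I < 0 \<or> capped_value n (binary_digits (nat \<bar>budget I\<bar>)) < card C + card C
       then ([], [], True, [True])
       else (map (\<lambda>u. map (adj a u) vs) vs, map (in_mod a) vs, False,
         binary_digits (min (length vs) (capped_value n (binary_digits (nat \<bar>budget I\<bar>)) - (card C + card C)))))"
    unfolding kernelize_def a Let_def by (simp only: removed_paths_eq vs_def length_a)
  show ?thesis
  proof (cases "budget I < 0 \<or> min n (nat (budget I)) < 2 * card C")
    case True
    then show ?thesis
      using k by (cases "budget I < 0") (simp_all add: kernelize kernel_instance_eq encoded_no_instance mult_2)
  next
    case False
    let ?J = "\<lparr>graph = relabel G vs, budget = int (min (length vs) (min n (nat (budget I)) - 2 * card C)),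
       modulator = {i. i < length vs \<and> vs ! i \<in> X}\<rparr>"
    have "input_of ?J = (map (\<lambda>u. map (adj a u) vs) vs, map (in_mod a) vs)"
      unfolding adj in_mod by (rule input_of_relabel) simp_all
    moreover have "kernel_instance I = ?J"
      unfolding kernel_instance_eq using False by (rule if_not_P)
    moreover have "kernelize (encoded I) = (map (\<lambda>u. map (adj a u) vs) vs, map (in_mod a) vs, False,
        binary_digits (min (length vs) (min n (nat (budget I)) - 2 * card C)))"
      using False k by (simp add: kernelize mult_2)
    ultimately show ?thesis
      by (simp add: encoded_def[of ?J])
  qed
qed

lemma kernel_instance_in_eds_instances: "kernel_instance I \<in> eds_instances"
  unfolding kernel_instance_eq
  using no_instance(1) simple_graph_relabel[OF simple] P5_component_graph_relabel
  by (auto simp: eds_instances_def)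

text \<open>The reduction is applied at the capped budget. By \<open>has_eds_min\<close> neither cap
  changes the answer, so a capped budget below \<open>2 * card C\<close> already refutes the
  instance.\<close>

lemma eds_yes_kernel_instance: "eds_yes (kernel_instance I) \<longleftrightarrow> eds_yes I"
proof (cases "budget I < 0 \<or> min n (nat (budget I)) < 2 * card C")
  case True
  then have "kernel_instance I = no_instance"
    unfolding kernel_instance_eq by (rule if_P)
  moreover have "\<not> eds_yes I"
    using True has_eds_reduction[of "min n (nat (budget I))"] has_eds_min[OF simple, of "nat (budget I)"]
    by (auto simp: eds_yes_iff)
  ultimately show ?thesis using no_instance(2) by simp
next
  case False
  let ?k = "min n (nat (budget I)) - 2 * card C"
  have "kernel_instance I = \<lparr>graph = relabel G vs, budget = int (min (length vs) ?k),
      modulator = {i. i < length vs \<and> vs ! i \<in> X}\<rparr>"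
    unfolding kernel_instance_eq using False by (rule if_not_P)
  then have "eds_yes (kernel_instance I) \<longleftrightarrow> has_eds (relabel G vs) (min (length vs) ?k)"
    by (simp add: eds_yes_iff)
  also have "\<dots> \<longleftrightarrow> has_eds (relabel G vs) ?k"
    using has_eds_min[OF simple_graph_relabel[OF simple], of vs ?k] by simp
  also have "\<dots> \<longleftrightarrow> has_eds (delete_vertices G deleted) ?k"
    by (rule has_eds_relabel[OF simple distinct_vs set_vs])
  also have "\<dots> \<longleftrightarrow> has_eds G (min n (nat (budget I)))"
    unfolding has_eds_reduction[of "min n (nat (budget I))"] using False by auto
  also have "\<dots> \<longleftrightarrow> eds_yes I"
    using False has_eds_min[OF simple] by (simp add: eds_yes_iff)
  finally show ?thesis .
qed

lemma card_kernel_instance: "card (verts (graph (kernel_instance I))) \<le> 6 * card X"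
  using length_vs by (simp add: kernel_instance_eq no_instance_def)

lemma budget_kernel_instance:
  \<comment> \<open>The successor allows for \<open>no_instance\<close>, which has no vertices and
    budget -1.\<close>
  "nat \<bar>budget (kernel_instance I)\<bar> \<le> Suc (card (verts (graph (kernel_instance I))))"
  by (simp add: kernel_instance_eq no_instance_def min.coboundedI1 le_SucI)

end

section \<open>Size of the code and conclusion\<close>

lemma length_binary_digits: "length (binary_digits n) \<le> n"
proof (induction n rule: binary_digits.induct)
  case (1 n)
  show ?case
  proof (cases "n = 0")
    case False
    then show ?thesis
      using 1 by (subst binary_digits.simps) simp
  qed (simp add: binary_digits.simps)
qed

lemma size_encode_instance:
  assumes "card (verts (graph I)) \<le> N" "nat \<bar>budget I\<bar> \<le> Suc N"
  shows "size (encode_instance I) \<le> 10 * (Suc N * Suc N)"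
proof -
  have bools: "size (enc bs) \<le> length bs * 2" for bs :: "bool list"
    using size_enc_list_le[of bs 1] size_enc_bool by simp
  let ?n = "card (verts (graph I))"
  have row: "size (enc r) \<le> 2 * N" if "r \<in> set (fst (input_of I))" for r
  proof -
    have "length r = ?n" using that by (auto simp: input_of_def Let_def)
    then show ?thesis using bools[of r] assms(1) by simp
  qed
  have "size (enc (fst (input_of I))) \<le> length (fst (input_of I)) * Suc (2 * N)"
    using row by (rule size_enc_list_le)
  also have "\<dots> \<le> N * Suc (2 * N)"
    using assms(1) by (intro mult_le_mono1) (simp add: input_of_def Let_def)
  finally have "size (enc (fst (input_of I))) \<le> N * Suc (2 * N)" .
  moreover have "size (enc (snd (input_of I))) \<le> 2 * N"
    using bools[of "snd (input_of I)"] assms(1) by (simp add: input_of_def Let_def)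
  moreover have "size (enc (binary_digits (nat \<bar>budget I\<bar>))) \<le> 2 * Suc N"
    using bools[of "binary_digits (nat \<bar>budget I\<bar>)"] length_binary_digits[of "nat \<bar>budget I\<bar>"] assms(2)
    by simp
  moreover have "size (enc (budget I < 0)) \<le> 1"
    by (rule size_enc_bool)
  ultimately show ?thesis
    by (simp add: encode_instance_eq encoded_def)
qed

lemma polytime_on_kernel_instance: "polytime_on encode_instance eds_instances kernel_instance"
proof -
  obtain c p where c: "\<And>i. runs c (enc i) (enc (kernelize i)) (poly p (size (enc i)))"
    using ptime_kernelize unfolding ptime_def by blast
  show ?thesis
    unfolding polytime_on_def
  proof (intro exI[of _ c] exI[of _ p] ballI)
    fix I assume "I \<in> eds_instances"
    then interpret eds_input I by unfold_locales
    show "\<exists>t. exec c (encode_instance I) (encode_instance (kernel_instance I)) t \<and>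
        t \<le> poly p (size (encode_instance I))"
      using c[of "encoded I"] by (auto simp: encode_instance_eq encoded_kernel_instance runs_def)
  qed
qed

lemma computable_if_ptime: "ptime h \<Longrightarrow> computable h"
  unfolding ptime_def computable_def runs_def enc_nat_def by blast

theorem theorem7:
  shows "\<exists>K. eds_kernelization K \<and>
    (\<exists>f :: nat \<Rightarrow> real. f \<in> O(\<lambda>n. real n) \<and>
      (\<forall>I\<in>eds_instances. real (card (verts (graph (K I)))) \<le> f (parameter I)))"
proof (intro exI conjI ballI)
  \<comment> \<open>The bound of \<open>size_encode_instance\<close> for \<open>6 * s\<close>
    vertices.\<close>
  define h :: "nat \<Rightarrow> nat" where "h s = 10 * (Suc (6 * s) * Suc (6 * s))" for s
  show "eds_kernelization kernel_instance"
    unfolding eds_kernelization_def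
  proof (intro conjI ballI exI)
    show "polytime_on encode_instance eds_instances kernel_instance"
      by (rule polytime_on_kernel_instance)
    show "computable h"
      unfolding h_def by (intro computable_if_ptime ptime_intros)
    fix I assume "I \<in> eds_instances"
    then interpret eds_input I by unfold_locales
    show "kernel_instance I \<in> eds_instances"
      by (rule kernel_instance_in_eds_instances)
    show "eds_yes (kernel_instance I) = eds_yes I"
      by (rule eds_yes_kernel_instance)
    show "size (encode_instance (kernel_instance I)) \<le> h (parameter I)"
      unfolding h_def parameter_def
      by (rule size_encode_instance[OF card_kernel_instance])
        (use budget_kernel_instance card_kernel_instance in linarith)
  qed
  show "(\<lambda>n. 6 * real n) \<in> O(\<lambda>n. real n)"
    by simp
  fix I assume "I \<in> eds_instances"
  then interpret eds_input I by unfold_locales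
  show "real (card (verts (graph (kernel_instance I)))) \<le> 6 * real (parameter I)"
    using card_kernel_instance by (simp add: parameter_def)
qed

end
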